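(* Let $n,p\ge 1$ be integers, let $\mathbb{X}\in\mathbb{R}^{n\times p}$, let $\mathbf{f}\in\mathbb{R}^n$, $\sigma>0$, and let $R\ge 0$ be a constant. Assume that $\boldsymbol{\xi}\sim\mathcal N(\mathbf 0,\sigma^2 I_{n\times n})$ and let $\mathbf y=\mathbf f+\boldsymbol\xi$. Let $F:\mathbb{R}^p\to[0,+\infty]$ be any proper convex function, and for each $\mathbf y\in\mathbb{R}^n$ let $\hat{\boldsymbol\beta}(\mathbf y)$ be a solution of $$\hat{\boldsymbol\beta}(\mathbf y)\in\operatorname*{argmin}_{\boldsymbol\beta\in\mathbb{R}^p}\left(\|\mathbf y-\mathbb X\boldsymbol\beta\|^2+2F(\boldsymbol\beta)\right).$$ Assume that $$\mathbb P\left(\|\mathbb X\hat{\boldsymbol\beta}(\mathbf y)-\mathbf f\|\le R\right)\ge 1/2,$$ or equivalently, that the median of $\|\mathbb X\hat{\boldsymbol\beta}(\mathbf y)-\mathbf f\|$ is at most $R$. Then, for all $t>0$, $$\mathbb P\left(\|\mathbb X\hat{\boldsymbol\beta}(\mathbf y)-\mathbf f\|\le R+\frac{\sigma t}{\sqrt n}\right)\ge\Phi(t),$$ and consequently, for all $x>0$, $$\mathbb P\left(\|\mathbb X\hat{\boldsymbol\beta}(\mathbf y)-\mathbf f\|\le R+\sigma\sqrt{2x/n}\right)\ge 1-e^{-x}.$$ Furthermore, $$\mathbb E\|\mathbb X\hat{\boldsymbol\beta}(\mathbf y)-\mathbf f\|\le R+\frac{\sigma}{\sqrt{2\pi n}}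.$$
   Context: For $\mathbf u\in\mathbb R^n$, $\|\mathbf u\|$ denotes the scaled Euclidean norm, $\|\mathbf u\|^2=\frac1n\sum_{i=1}^n u_i^2$. $\Phi$ is the cumulative distribution function of $\mathcal N(0,1)$. A proper convex function $F:\mathbb R^p\to[0,+\infty]$ is a nonnegative convex function with $F(\boldsymbol\beta)<+\infty$ for at least one $\boldsymbol\beta$. It is assumed that a minimizer $\hat{\boldsymbol\beta}(\mathbf y)$ exists for every $\mathbf y\in\mathbb R^n$ (any choice of minimizer is allowed). A median of a real random variable $Z$ is a real number $M$ with $\mathbb P(Z\ge M)\ge 1/2$ and $\mathbb P(Z\le M)\ge 1/2$. *)

theory Defs
  imports "HOL-Probability.Probability"
begin

definition scaled_norm :: "real ^ 'n \<Rightarrow> real" where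
  "scaled_norm u = sqrt (1 / real CARD('n) * (\<Sum>i\<in>UNIV. (u $ i)\<^sup>2))"

(* Nonnegativity is built into the codomain ennreal = [0, infinity], where 0 * infinity = 0. *)
definition proper_convex :: "('a::real_vector \<Rightarrow> ennreal) \<Rightarrow> bool" where
  "proper_convex F \<longleftrightarrow>
     (\<forall>x y u v. 0 \<le> u \<longrightarrow> 0 \<le> v \<longrightarrow> u + v = 1 \<longrightarrow>
        F (u *\<^sub>R x + v *\<^sub>R y) \<le> ennreal u * F x + ennreal v * F y) \<and>
     (\<exists>x. F x < \<infinity>)"

definition penalized_loss ::
    "real ^ 'p ^ 'n \<Rightarrow> (real ^ 'p \<Rightarrow> ennreal) \<Rightarrow> real ^ 'n \<Rightarrow> real ^ 'p \<Rightarrow> ennreal" where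
  "penalized_loss X F y \<beta> = ennreal ((scaled_norm (y - X *v \<beta>))\<^sup>2) + 2 * F \<beta>"

definition is_median :: "'w measure \<Rightarrow> ('w \<Rightarrow> real) \<Rightarrow> real \<Rightarrow> bool" where
  "is_median M Z m \<longleftrightarrow> \<P>(\<omega> in M. Z \<omega> \<ge> m) \<ge> 1/2 \<and> \<P>(\<omega> in M. Z \<omega> \<le> m) \<ge> 1/2"

(* The Lebesgue density of N(0, s^2 I) is the product of the one-dimensional densities;
   the second parameter of normal_density is the standard deviation. *)
definition isotropic_normal_density :: "real \<Rightarrow> real ^ 'n \<Rightarrow> real" where
  "isotropic_normal_density s x = (\<Prod>i\<in>UNIV. normal_density 0 s (x $ i))"

end

(*
The estimator \<open>v \<mapsto> X \<beta>hat(v)\<close> is a proximal map, hence nonexpansive, so the loss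
is a Lipschitz function of a standard Gaussian vector with constant \<open>\<sigma> / sqrt n\<close>.  All three
bounds then follow from the Gaussian isoperimetric inequality: a set of measure at least
\<open>\<Phi>(z)\<close> has a \<open>t\<close>-neighbourhood of measure at least \<open>\<Phi>(z + t)\<close>.

On the line the inequality is proved by applying to each component of the neighbourhood the bathtub
principle for Gaussian shifts.  In higher dimension one symmetrises in the sense of Ehrhard: every
slice of a set along a direction is replaced by a half-line of the same Gaussian measure, which by
the one-dimensional case does not increase the measure of neighbourhoods.  Among the closed sets
contradicting the inequality, compactness gives one with the largest overlap with a half-space of
measure \<open>\<Phi>(z)\<close>.  By maximality no symmetrisation increases the overlap, which forces the set to
contain the half-space, and then its neighbourhood is as large as claimed.
*)

theory Submission
  imports Defs "HOL-Complex_Analysis.Great_Picard"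
begin

section \<open>The standard normal distribution on the line\<close>

text \<open>A bound of exactly \<open>Phi t\<close> above an arbitrary median level calls for the
  sharp isoperimetric inequality; exponential-moment arguments concentrate around the mean and lose
  constants. The constant in the bound for the expectation is the mean of the positive part of a
  standard normal variable, whose tails dominate those of the normalised excess over
  \<open>R\<close>. On the line the inequality is read from outside in: in an open set of mass
  \<open>Phi \<zeta>\<close>, the points whose \<open>r\<close>-ball stays inside have mass at most
  \<open>Phi (\<zeta> - r)\<close>. Spreading the mass over several components only lowers that
  amount, because \<open>Phi (t - r) / Phi t\<close> increases with \<open>t\<close>. In higher
  dimension no sequence of symmetrisations has to be shown to converge to a half-space: at an
  extremal set one strictly improving symmetrisation is already a contradiction. The price is that
  an extremal set must exist. This is why competitors are closed, and why neighbourhoods are unions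
  of open balls: these do not change under closure, and their strict inequalities leave the slack
  that a limit needs.\<close>

abbreviation Phi :: "real \<Rightarrow> real" where
  "Phi \<equiv> cdf std_normal_distribution"

interpretation std_normal: real_distribution std_normal_distribution
  by (rule real_dist_normal_dist)

text \<open>The density is strictly positive, so both measures have the same null sets. This makes
  \<open>Phi\<close> strictly increasing and later lets null sets be translated, since Lebesgue
  measure is translation invariant.\<close>

lemma std_normal_null_iff:
  assumes "S \<in> sets borel"
  shows "measure std_normal_distribution S = 0 \<longleftrightarrow> emeasure lborel S = 0"
proof -
  have "measure std_normal_distribution S = 0 \<longleftrightarrow> S \<in> null_sets std_normal_distribution"
    using assms by (simp add: std_normal.emeasure_eq_measure null_sets_def)
  also have "\<dots> \<longleftrightarrow> (AE x\<in>S in lborel. ennreal (std_normal_density x) = 0)"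
    using assms by (subst null_sets_density_iff) auto
  also have "\<dots> \<longleftrightarrow> (AE x in lborel. x \<notin> S)"
  proof -
    have "\<And>x. ennreal (std_normal_density x) \<noteq> 0"
      using normal_density_pos[of 1] by (simp add: ennreal_eq_0_iff not_le)
    then show ?thesis by simp
  qed
  also have "\<dots> \<longleftrightarrow> emeasure lborel S = 0"
    using assms by (subst AE_iff_measurable[where N=S]) auto
  finally show ?thesis .
qed

lemma std_normal_singleton [simp]: "measure std_normal_distribution {x} = 0"
  by (subst std_normal_null_iff) auto

lemma isCont_Phi: "isCont Phi x"
  by (simp add: std_normal.isCont_cdf)

lemma Phi_strict_mono: assumes "x < y" shows "Phi x < Phi y"
proof -
  have "Phi y - Phi x = measure std_normal_distribution {x<..y}"
    using assms by (rule std_normal.cdf_diff_eq)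
  moreover have "measure std_normal_distribution {x<..y} \<noteq> 0"
    using assms by (subst std_normal_null_iff) auto
  ultimately show ?thesis
    by (smt (verit) measure_nonneg)
qed

lemma Phi_less_iff [simp]: "Phi x < Phi y \<longleftrightarrow> x < y"
  by (metis Phi_strict_mono less_asym linorder_neqE)

lemma Phi_le_iff [simp]: "Phi x \<le> Phi y \<longleftrightarrow> x \<le> y"
  by (metis Phi_less_iff not_less)

lemma Phi_pos: "0 < Phi x"
  using Phi_strict_mono[of "x - 1" x] std_normal.cdf_nonneg[of "x - 1"] by linarith

lemma Phi_less_1: "Phi x < 1"
  using Phi_strict_mono[of x "x + 1"] std_normal.cdf_bounded_prob[of "x + 1"] by linarith

lemma Phi_surj:
  assumes "0 < p" "p < 1"
  obtains z where "Phi z = p"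
proof -
  obtain a where a: "Phi a < p"
    using order_tendstoD(2)[OF std_normal.cdf_lim_at_bot \<open>0 < p\<close>]
    by (auto simp: eventually_at_bot_linorder)
  obtain b where b: "p < Phi b"
    using order_tendstoD(1)[OF std_normal.cdf_lim_at_top_prob \<open>p < 1\<close>]
    by (auto simp: eventually_at_top_linorder)
  have "a \<le> b"
    using a b Phi_less_iff[of a b] by linarith
  then have "\<exists>x\<ge>a. x \<le> b \<and> Phi x = p"
    using a b isCont_Phi by (intro IVT) auto
  then show ?thesis using that by blast
qed

section \<open>Shifts of the standard normal law\<close>

text \<open>One-dimensional Cameron-Martin formula: the exponential is the ratio of the normal
  densities at \<open>s - r\<close> and at \<open>s\<close>. For \<open>r \<ge> 0\<close> it
  increases in \<open>s\<close>, which is all that the comparisons below use.\<close>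

lemma std_normal_shift:
  assumes [measurable]: "E \<in> sets borel"
  shows "emeasure std_normal_distribution {x. x + r \<in> E} =
    (\<integral>\<^sup>+s. ennreal (exp (s * r - r\<^sup>2 / 2)) * indicator E s \<partial>std_normal_distribution)"
proof -
  have e: "std_normal_density (s - r) = std_normal_density s * exp (s * r - r\<^sup>2 / 2)" for s
  proof -
    have "- (s - r)\<^sup>2 / 2 = - s\<^sup>2 / 2 + (s * r - r\<^sup>2 / 2)"
      by (simp add: field_simps power2_eq_square)
    then show ?thesis
      unfolding std_normal_density_def by (simp only: exp_add)
  qed
  have "emeasure std_normal_distribution {x. x + r \<in> E} =
      (\<integral>\<^sup>+x. ennreal (std_normal_density x) * indicator E (x + r) \<partial>lborel)"
    by (subst emeasure_density) (auto simp: indicator_def)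
  also have "\<dots> = (\<integral>\<^sup>+s. ennreal (std_normal_density (s - r)) * indicator E s \<partial>lborel)"
    by (subst nn_integral_real_affine[where c=1 and t="- r"]) (auto simp: algebra_simps)
  also have "\<dots> = (\<integral>\<^sup>+s. ennreal (std_normal_density s) * (ennreal (exp (s * r - r\<^sup>2 / 2)) * indicator E s) \<partial>lborel)"
    by (simp add: e ennreal_mult mult.assoc)
  also have "\<dots> = (\<integral>\<^sup>+s. ennreal (exp (s * r - r\<^sup>2 / 2)) * indicator E s \<partial>std_normal_distribution)"
    by (subst nn_integral_density) auto
  finally show ?thesis .
qed

lemma std_normal_shift_le:
  assumes [measurable]: "E \<in> sets borel" and "r \<ge> 0" "\<And>x. x \<in> E \<Longrightarrow> x \<le> D"
  shows "measure std_normal_distribution {x. x + r \<in> E}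
    \<le> exp (D * r - r\<^sup>2 / 2) * measure std_normal_distribution E"
proof -
  have "emeasure std_normal_distribution {x. x + r \<in> E}
      \<le> (\<integral>\<^sup>+s. ennreal (exp (D * r - r\<^sup>2 / 2)) * indicator E s \<partial>std_normal_distribution)"
    unfolding std_normal_shift[OF assms(1)] using assms
    by (intro nn_integral_mono) (auto simp: indicator_def mult_right_mono intro!: ennreal_leI)
  also have "\<dots> = ennreal (exp (D * r - r\<^sup>2 / 2)) * emeasure std_normal_distribution E"
    by (simp add: nn_integral_cmult)
  finally show ?thesis
    by (simp add: std_normal.emeasure_eq_measure flip: ennreal_mult')
qed

lemma std_normal_shift_ge:
  assumes [measurable]: "E \<in> sets borel" and "r \<ge> 0" "\<And>x. x \<in> E \<Longrightarrow> D \<le> x"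
  shows "exp (D * r - r\<^sup>2 / 2) * measure std_normal_distribution E
    \<le> measure std_normal_distribution {x. x + r \<in> E}"
proof -
  have "ennreal (exp (D * r - r\<^sup>2 / 2)) * emeasure std_normal_distribution E =
      (\<integral>\<^sup>+s. ennreal (exp (D * r - r\<^sup>2 / 2)) * indicator E s \<partial>std_normal_distribution)"
    by (simp add: nn_integral_cmult)
  also have "\<dots> \<le> emeasure std_normal_distribution {x. x + r \<in> E}"
    unfolding std_normal_shift[OF assms(1)] using assms
    by (intro nn_integral_mono) (auto simp: indicator_def mult_right_mono intro!: ennreal_leI)
  finally show ?thesis
    by (simp add: std_normal.emeasure_eq_measure flip: ennreal_mult')
qed

text \<open>Bathtub principle: mass further to the right is worth more after a shift to the left. At
  the threshold \<open>D\<close> the density ratio bounds the gain of \<open>E - E'\<close> from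
  above and that of \<open>E' - E\<close> from below, and the common part cancels.\<close>

lemma std_normal_shift_mono:
  assumes [measurable]: "E \<in> sets borel" "E' \<in> sets borel" and "r \<ge> 0"
    and le: "measure std_normal_distribution E \<le> measure std_normal_distribution E'"
    and "\<And>x. x \<in> E - E' \<Longrightarrow> x \<le> D" "\<And>x. x \<in> E' - E \<Longrightarrow> D \<le> x"
  shows "measure std_normal_distribution {x. x + r \<in> E} \<le> measure std_normal_distribution {x. x + r \<in> E'}"
proof -
  let ?m = "measure std_normal_distribution"
  have split: "?m {x. x + r \<in> A} = ?m {x. x + r \<in> A \<inter> B} + ?m {x. x + r \<in> A - B}"
    if [measurable]: "A \<in> sets borel" "B \<in> sets borel" for A B :: "real set" and r
  proof -
    have "{x. x + r \<in> A} = {x. x + r \<in> A \<inter> B} \<union> {x. x + r \<in> A - B}" by auto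
    then show ?thesis
      using std_normal.finite_measure_Union[of "{x. x + r \<in> A \<inter> B}" "{x. x + r \<in> A - B}"]
      by simp auto
  qed
  have "?m (E - E') \<le> ?m (E' - E)"
    using split[of E E' 0] split[of E' E 0] le by (simp add: Int_commute set_diff_eq Int_def conj_commute)
  then have "exp (D * r - r\<^sup>2 / 2) * ?m (E - E') \<le> exp (D * r - r\<^sup>2 / 2) * ?m (E' - E)"
    by simp
  moreover have "?m {x. x + r \<in> E - E'} \<le> exp (D * r - r\<^sup>2 / 2) * ?m (E - E')"
    using assms by (intro std_normal_shift_le) auto
  moreover have "exp (D * r - r\<^sup>2 / 2) * ?m (E' - E) \<le> ?m {x. x + r \<in> E' - E}"
    using assms by (intro std_normal_shift_ge) auto
  ultimately have "?m {x. x + r \<in> E - E'} \<le> ?m {x. x + r \<in> E' - E}"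
    by linarith
  then show ?thesis
    using split[of E E' r] split[of E' E r] by (simp add: Int_commute)
qed

lemma std_normal_measure_atMost [simp]: "measure std_normal_distribution {..z} = Phi z"
  by (simp add: cdf_def)

lemma std_normal_measure_lessThan [simp]: "measure std_normal_distribution {..<z} = Phi z"
proof -
  have "measure std_normal_distribution ({..<z} \<union> {z}) =
      measure std_normal_distribution {..<z} + measure std_normal_distribution {z}"
    by (rule std_normal.finite_measure_Union) auto
  also have "{..<z} \<union> {z} = {..z}" by auto
  finally show ?thesis by simp
qed

lemma std_normal_measure_greaterThan [simp]: "measure std_normal_distribution {z<..} = 1 - Phi z"
  using std_normal.prob_compl[of "{..z}"] by (simp add: Compl_eq_Diff_UNIV[symmetric])

lemma std_normal_measure_atLeast [simp]: "measure std_normal_distribution {z..} = 1 - Phi z"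
  using std_normal.prob_compl[of "{..<z}"] by (simp add: Compl_eq_Diff_UNIV[symmetric])

lemma std_normal_measure_greaterThanAtMost [simp]:
  "a \<le> b \<Longrightarrow> measure std_normal_distribution {a<..b} = Phi b - Phi a"
  using std_normal.cdf_diff_eq[of a b] by (cases "a = b") auto

lemma std_normal_measure_greaterThanLessThan [simp]:
  assumes "a \<le> b" shows "measure std_normal_distribution {a<..<b} = Phi b - Phi a"
proof (cases "a = b")
  case False
  have "measure std_normal_distribution ({a<..<b} \<union> {b}) =
      measure std_normal_distribution {a<..<b} + measure std_normal_distribution {b}"
    by (rule std_normal.finite_measure_Union) auto
  also have "{a<..<b} \<union> {b} = {a<..b}" using assms False by auto
  finally show ?thesis using assms by simp
qed auto

lemma std_normal_measure_atLeastAtMost [simp]: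
  assumes "a \<le> b" shows "measure std_normal_distribution {a..b} = Phi b - Phi a"
proof -
  have "measure std_normal_distribution ({a} \<union> {a<..b}) =
      measure std_normal_distribution {a} + measure std_normal_distribution {a<..b}"
    by (rule std_normal.finite_measure_Union) auto
  also have "{a} \<union> {a<..b} = {a..b}" using assms by auto
  finally show ?thesis using assms by simp
qed

lemma Phi_minus: "Phi (- z) = 1 - Phi z"
proof -
  have "emeasure std_normal_distribution {..- z} =
      (\<integral>\<^sup>+x. ennreal (std_normal_density x) * indicator {..- z} x \<partial>lborel)"
    by (simp add: emeasure_density)
  also have "\<dots> = (\<integral>\<^sup>+x. ennreal (std_normal_density x) * indicator {z..} x \<partial>lborel)"
    by (subst nn_integral_real_affine[where c="-1" and t=0])
       (auto intro!: nn_integral_cong simp: indicator_def std_normal_density_def)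
  also have "\<dots> = emeasure std_normal_distribution {z..}"
    by (simp add: emeasure_density)
  finally show ?thesis
    by (simp add: std_normal.emeasure_eq_measure std_normal.cdf_bounded_prob std_normal.cdf_nonneg)
qed

lemma Phi_0: "Phi 0 = 1 / 2"
  using Phi_minus[of 0] by simp

section \<open>Isoperimetry on the line\<close>

lemma ball_subset_closed_imp_cball:
  fixes x :: "'a::real_normed_vector"
  assumes "closed C" "ball x r \<subseteq> C" "r > 0"
  shows "cball x r \<subseteq> C"
  using closure_minimal[OF assms(2,1)] assms(3) by simp

lemma closed_shrink: "closed {x. ball x r \<subseteq> (J :: 'a::metric_space set)}"
proof -
  have "{x. ball x r \<subseteq> J} = - (\<Union>y\<in>-J. ball y r)"
    by (auto simp: dist_commute)
  then show ?thesis by (auto simp: closed_def)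
qed

text \<open>Among intervals of given mass a half-line loses least when its \<open>r\<close>-collar
  is removed. Unbounded intervals are half-lines up to reflection; a bounded one is compared with
  half-lines by the bathtub principle.\<close>

lemma std_normal_shrink_interval:
  assumes J: "is_interval J" and r: "r > 0"
    and eta: "measure std_normal_distribution J = Phi \<eta>"
  shows "measure std_normal_distribution {x. ball x r \<subseteq> J} \<le> Phi (\<eta> - r)"
proof -
  let ?K = "{x. ball x r \<subseteq> J}"
  have [measurable]: "?K \<in> sets borel"
    by (simp add: closed_shrink borel_closed)
  \<comment> \<open>Passing to a closed superset \<open>C\<close> makes the end points of the open
    ball available, whichever end points \<open>J\<close> itself contains.\<close>
  have ends: "x - r \<in> C" "x + r \<in> C" if "x \<in> ?K" "J \<subseteq> C" "closed C" for x C
    using ball_subset_closed_imp_cball[of C x r] that r by (auto simp: subset_iff dist_real_def)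
  have "J \<noteq> {}" "J \<noteq> UNIV"
    using eta Phi_pos[of \<eta>] Phi_less_1[of \<eta>] std_normal.prob_space by auto
  then consider (below) b where "J \<subseteq> {..b}" "measure std_normal_distribution J = Phi b"
    | (above) a where "J \<subseteq> {a..}" "measure std_normal_distribution J = 1 - Phi a"
    | (bounded) a b where "a \<le> b" "J \<subseteq> {a..b}" "measure std_normal_distribution J = Phi b - Phi a"
  proof -
    have "\<exists>a b. J = {} \<or> J = UNIV \<or> J = {..<b} \<or> J = {..b} \<or> J = {a<..} \<or> J = {a..} \<or>
      J = {a<..<b} \<or> J = {a<..b} \<or> J = {a..<b} \<or> J = {a..b}"
      using J unfolding is_interval_1 by (intro interval_cases) blast
    then obtain a b where c: "J = {..<b} \<or> J = {..b} \<or> J = {a<..} \<or> J = {a..} \<or>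
      J = {a<..<b} \<or> J = {a<..b} \<or> J = {a..<b} \<or> J = {a..b}"
      using \<open>J \<noteq> {}\<close> \<open>J \<noteq> UNIV\<close> by blast
    have lt: "measure std_normal_distribution {a..<b} = Phi b - Phi a" if "a \<le> b"
    proof -
      have "measure std_normal_distribution {a<..<b} \<le> measure std_normal_distribution {a..<b}"
        "measure std_normal_distribution {a..<b} \<le> measure std_normal_distribution {a..b}"
        by (auto intro!: std_normal.finite_measure_mono)
      then show ?thesis using that by simp
    qed
    have sub: "a \<le> b" "J \<subseteq> {a..b}"
      if "J = {a<..<b} \<or> J = {a<..b} \<or> J = {a..<b} \<or> J = {a..b}"
      using that \<open>J \<noteq> {}\<close> by (auto simp: not_le[symmetric])
    from c consider "J = {..<b} \<or> J = {..b}" | "J = {a<..} \<or> J = {a..}"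
      | "J = {a<..<b} \<or> J = {a<..b} \<or> J = {a..<b} \<or> J = {a..b}"
      by argo
    then show ?thesis
    proof cases
      case 1
      then show ?thesis by (intro below[of b]) auto
    next
      case 2
      then show ?thesis by (intro above[of a]) auto
    next
      case 3
      then have "measure std_normal_distribution J = Phi b - Phi a"
        using sub(1) lt by (elim disjE) simp_all
      then show ?thesis using sub[OF 3] by (intro bounded)
    qed
  qed
  then show ?thesis
  proof cases
    case below
    then have "?K \<subseteq> {..b - r}"
      using ends[of _ "{..b}"] by fastforce
    then have "measure std_normal_distribution ?K \<le> measure std_normal_distribution {..b - r}"
      by (intro std_normal.finite_measure_mono) auto
    moreover have "b = \<eta>"
      using below(2) eta by (metis Phi_le_iff order_antisym order_refl)
    ultimately show ?thesis by simp
  next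
    case above
    then have "?K \<subseteq> {a + r..}"
      using ends[of _ "{a..}"] by fastforce
    then have "measure std_normal_distribution ?K \<le> measure std_normal_distribution {a + r..}"
      by (intro std_normal.finite_measure_mono) auto
    also have "\<dots> = Phi (- a - r)"
      using Phi_minus[of "a + r"] by simp
    also have "- a = \<eta>"
      using above(2) eta Phi_minus[of a] by (metis Phi_le_iff order_antisym order_refl)
    finally show ?thesis .
  next
    case bounded
    have ab: "Phi \<eta> = Phi b - Phi a" using bounded eta by simp
    have "\<eta> \<le> b" using ab Phi_pos[of a] by (subst Phi_le_iff[symmetric]) linarith
    \<comment> \<open>Both sets have mass \<open>Phi a\<close>: the first because
      \<open>Phi \<eta> = Phi b - Phi a\<close>, the second by symmetry. The second one is a right
      half-line, so it gains at least as much from the shift to the left.\<close>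
    have "measure std_normal_distribution {x. x + r \<in> {\<eta><..b}}
        \<le> measure std_normal_distribution {x. x + r \<in> {- a<..}}"
      using r ab \<open>\<eta> \<le> b\<close>
      by (intro std_normal_shift_mono[where D="- a"]) (auto simp: Phi_minus)
    moreover have "{x. x + r \<in> {\<eta><..b}} = {\<eta> - r<..b - r}" "{x. x + r \<in> {- a<..}} = {- a - r<..}"
      by auto
    ultimately have le: "Phi (b - r) - Phi (a + r) \<le> Phi (\<eta> - r)"
      using \<open>\<eta> \<le> b\<close> Phi_minus[of "a + r"] by simp
    have sub: "?K \<subseteq> {a + r..b - r}"
      using ends[of _ "{a..b}"] bounded by fastforce
    show ?thesis
    proof (cases "a + r \<le> b - r")
      case True
      have "measure std_normal_distribution ?K \<le> measure std_normal_distribution {a + r..b - r}"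
        using sub by (intro std_normal.finite_measure_mono) auto
      then show ?thesis using le True by simp
    next
      case False
      then have "?K = {}" using sub by auto
      then show ?thesis using Phi_pos[of "\<eta> - r"] by (simp add: less_imp_le)
    qed
  qed
qed

text \<open>Says that \<open>Phi (t - r) / Phi t\<close> is nondecreasing in \<open>t\<close>, in a
  form free of division. The density ratio \<open>c\<close> at \<open>\<eta>\<close> bounds the
  average ratio below \<open>\<eta>\<close> from above and the one on
  \<open>{\<eta><..\<zeta>}\<close> from below.\<close>

lemma Phi_ratio_mono:
  assumes "\<eta> \<le> \<zeta>" "r \<ge> 0"
  shows "Phi (\<eta> - r) * Phi \<zeta> \<le> Phi (\<zeta> - r) * Phi \<eta>"
proof -
  define c where "c = exp (\<eta> * r - r\<^sup>2 / 2)"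
  have "{x. x + r \<in> {..\<eta>}} = {..\<eta> - r}" "{x. x + r \<in> {\<eta><..\<zeta>}} = {\<eta> - r<..\<zeta> - r}" by auto
  then have "Phi (\<eta> - r) \<le> c * Phi \<eta>" and "c * (Phi \<zeta> - Phi \<eta>) \<le> Phi (\<zeta> - r) - Phi (\<eta> - r)"
    using std_normal_shift_le[of "{..\<eta>}" r \<eta>] std_normal_shift_ge[of "{\<eta><..\<zeta>}" r \<eta>] assms
    by (auto simp: c_def)
  moreover have "0 \<le> Phi \<eta>" "0 \<le> Phi \<zeta> - Phi \<eta>"
    using Phi_pos[of \<eta>] assms by auto
  ultimately have "Phi (\<eta> - r) * (Phi \<zeta> - Phi \<eta>) \<le> (c * Phi \<eta>) * (Phi \<zeta> - Phi \<eta>)"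
    "(c * (Phi \<zeta> - Phi \<eta>)) * Phi \<eta> \<le> (Phi (\<zeta> - r) - Phi (\<eta> - r)) * Phi \<eta>"
    by (auto intro!: mult_right_mono)
  then show ?thesis by (simp add: algebra_simps)
qed

text \<open>Each component of the neighbourhood keeps at most the fraction \<open>l\<close> of its
  mass after shrinking, where \<open>l\<close> is the fraction for a half-line with the mass of the
  whole neighbourhood. A common fraction can be summed over the countably many components.\<close>

lemma std_normal_isoperimetric:
  assumes [measurable]: "A \<in> sets borel" and r: "r > 0"
    and z: "Phi z \<le> measure std_normal_distribution A"
  shows "Phi (z + r) \<le> measure std_normal_distribution (\<Union>x\<in>A. ball x r)"
proof (rule ccontr)
  define U where "U = (\<Union>x\<in>A. ball x r)"
  define shrink where "shrink J = {x. ball x r \<subseteq> J}" for J :: "real set"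
  have U: "open U" "A \<subseteq> U" using r by (auto simp: U_def)
  have [measurable]: "U \<in> sets borel" "\<And>J. shrink J \<in> sets borel"
    using U by (auto simp: shrink_def closed_shrink borel_closed)
  assume "\<not> Phi (z + r) \<le> measure std_normal_distribution (\<Union>x\<in>A. ball x r)"
  then have less: "measure std_normal_distribution U < Phi (z + r)" by (simp add: U_def)
  have "Phi z \<le> measure std_normal_distribution U"
    using z std_normal.finite_measure_mono[of A U] U by auto
  \<comment> \<open>The negated claim keeps the mass of \<open>U\<close> below 1, so that a real
    \<open>\<zeta>\<close> exists.\<close>
  then have "0 < measure std_normal_distribution U" "measure std_normal_distribution U < 1"
    using less Phi_less_1[of "z + r"] Phi_pos[of z] by linarith+
  then obtain \<zeta> where \<zeta>: "measure std_normal_distribution U = Phi \<zeta>"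
    by (metis Phi_surj)
  define C where "C = components U"
  define l where "l = Phi (\<zeta> - r) / Phi \<zeta>"
  have comp: "open J" "is_interval J" "J \<subseteq> U" if "J \<in> C" for J
    using that open_components[OF U(1)] in_components_connected[of J U] in_components_subset[of J U]
    by (auto simp: C_def is_interval_connected_1)
  have "countable C"
    using comp pairwise_disjoint_components[of U]
    by (intro countable_disjoint_open_subsets) (auto simp: C_def pairwise_def disjnt_def)
  have sJ: "shrink J \<subseteq> J" for J using r by (auto simp: shrink_def)
  have disj: "disjoint_family_on (\<lambda>J. J) C"
    using pairwise_disjoint_components[of U]
    by (auto simp: disjoint_family_on_def pairwise_def C_def)
  then have disj': "disjoint_family_on shrink C"
    using sJ unfolding disjoint_family_on_def by blast
  \<comment> \<open>A ball around a point of \<open>A\<close> is connected and contained in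
    \<open>U\<close>, hence contained in a single component.\<close>
  have A: "A \<subseteq> (\<Union>J\<in>C. shrink J)"
  proof
    fix x assume "x \<in> A"
    then have "ball x r \<subseteq> U" "connected (ball x r)" by (auto simp: U_def)
    then obtain J where "J \<in> C" "ball x r \<subseteq> J"
      using exists_component_superset[of "ball x r" U] \<open>x \<in> A\<close> U(2) by (auto simp: C_def)
    then show "x \<in> (\<Union>J\<in>C. shrink J)" by (auto simp: shrink_def)
  qed
  have one: "measure std_normal_distribution (shrink J) \<le> l * measure std_normal_distribution J"
    if "J \<in> C" for J
  proof (cases "measure std_normal_distribution J = 0")
    case True
    then show ?thesis
      using std_normal.finite_measure_mono[OF sJ, of J] comp[OF that] by simp
  next
    case False
    have le: "measure std_normal_distribution J \<le> Phi \<zeta>"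
      unfolding \<zeta>[symmetric] using comp[OF that] by (intro std_normal.finite_measure_mono) auto
    have "0 < measure std_normal_distribution J" "measure std_normal_distribution J < 1"
      using False le Phi_less_1[of \<zeta>] measure_nonneg[of std_normal_distribution J] by linarith+
    then obtain \<eta> where \<eta>: "measure std_normal_distribution J = Phi \<eta>"
      by (metis Phi_surj)
    then have "\<eta> \<le> \<zeta>" using le by simp
    have "measure std_normal_distribution (shrink J) \<le> Phi (\<eta> - r)"
      unfolding shrink_def using comp[OF that] r \<eta> by (intro std_normal_shrink_interval)
    also have "\<dots> \<le> l * Phi \<eta>"
      using Phi_ratio_mono[OF \<open>\<eta> \<le> \<zeta>\<close>, of r] r Phi_pos[of \<zeta>] by (simp add: l_def field_simps)
    finally show ?thesis by (simp add: \<eta>)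
  qed
  have "emeasure std_normal_distribution A \<le> emeasure std_normal_distribution (\<Union>J\<in>C. shrink J)"
    using A \<open>countable C\<close> by (intro emeasure_mono) (auto intro!: sets.countable_UN'')
  also have "\<dots> = (\<integral>\<^sup>+J. emeasure std_normal_distribution (shrink J) \<partial>count_space C)"
    using \<open>countable C\<close> disj' by (intro emeasure_UN_countable) auto
  also have "\<dots> \<le> (\<integral>\<^sup>+J. ennreal l * emeasure std_normal_distribution J \<partial>count_space C)"
    using one Phi_pos[of \<zeta>] Phi_pos[of "\<zeta> - r"]
    by (intro nn_integral_mono) (auto simp: std_normal.emeasure_eq_measure l_def simp flip: ennreal_mult')
  also have "\<dots> = ennreal l * emeasure std_normal_distribution (\<Union>J\<in>C. J)"
    using \<open>countable C\<close> disj comp(1)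
    by (subst emeasure_UN_countable) (auto simp: nn_integral_cmult)
  also have "(\<Union>J\<in>C. J) = U" by (simp add: C_def)
  finally have "measure std_normal_distribution A \<le> Phi (\<zeta> - r)"
    using Phi_pos[of \<zeta>] Phi_pos[of "\<zeta> - r"]
    by (simp add: std_normal.emeasure_eq_measure \<zeta> l_def less_imp_le flip: ennreal_mult')
  then have "Phi z \<le> Phi (\<zeta> - r)" using z by linarith
  then have "Phi (z + r) \<le> Phi \<zeta>" by simp
  then show False using less \<zeta> by simp
qed

section \<open>Gaussian slices and Ehrhard symmetrisation\<close>

definition gauss_density :: "'a::euclidean_space \<Rightarrow> real" where
  "gauss_density x = (\<Prod>b\<in>Basis. std_normal_density (x \<bullet> b))"

definition gauss :: "'a::euclidean_space measure" where
  "gauss = density lborel (\<lambda>x. ennreal (gauss_density x))"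

lemma gauss_density_norm:
  fixes x :: "'a::euclidean_space"
  shows "gauss_density x = (1 / sqrt (2 * pi)) ^ DIM('a) * exp (- (norm x)\<^sup>2 / 2)"
proof -
  have "(norm x)\<^sup>2 = (\<Sum>b\<in>Basis. (x \<bullet> b)\<^sup>2)"
    unfolding power2_norm_eq_inner by (subst euclidean_inner) (simp add: power2_eq_square)
  then show ?thesis
    by (simp add: gauss_density_def std_normal_density_def prod.distrib prod_dividef power_divide sum_divide_distrib
        flip: exp_sum sum_negf)
qed

lemma gauss_density_pos: "0 < gauss_density x"
  unfolding gauss_density_def by (intro prod_pos normal_density_pos) simp

lemma borel_measurable_gauss_density [measurable]: "gauss_density \<in> borel_measurable borel"
  unfolding gauss_density_def by measurable

lemma sets_gauss [simp, measurable_cong]: "sets gauss = sets borel"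
  by (simp add: gauss_def)

lemma space_gauss [simp]: "space gauss = UNIV"
  by (simp add: gauss_def)

lemma nn_integral_gauss:
  assumes [measurable]: "F \<in> borel_measurable borel"
  shows "(\<integral>\<^sup>+x. F x \<partial>gauss) = (\<integral>\<^sup>+x. ennreal (gauss_density x) * F x \<partial>lborel)"
  unfolding gauss_def by (subst nn_integral_density) auto

lemma prob_space_gauss: "prob_space (gauss :: 'a::euclidean_space measure)"
proof
  have "emeasure (gauss :: 'a measure) (space gauss) = (\<integral>\<^sup>+x. ennreal (gauss_density (x::'a)) \<partial>lborel)"
    by (simp add: gauss_def emeasure_density)
  also have "\<dots> = (\<integral>\<^sup>+x. (\<Prod>b\<in>Basis. ennreal (std_normal_density ((x::'a) \<bullet> b))) \<partial>lborel)"
    by (simp add: gauss_density_def prod_ennreal)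
  also have "\<dots> = (\<Prod>b\<in>(Basis::'a set). (\<integral>\<^sup>+x. ennreal (std_normal_density x) \<partial>lborel))"
    by (subst nn_integral_lborel_prod) auto
  also have "(\<integral>\<^sup>+x. ennreal (std_normal_density x) \<partial>lborel) = 1"
    using std_normal.emeasure_space_1 by (simp add: emeasure_density)
  finally show "emeasure (gauss :: 'a measure) (space gauss) = 1" by simp
qed

interpretation gauss: prob_space "gauss :: 'a::euclidean_space measure"
  by (rule prob_space_gauss)

lemma gauss_null_iff:
  fixes S :: "'a::euclidean_space set"
  assumes "S \<in> sets borel"
  shows "measure gauss S = 0 \<longleftrightarrow> emeasure lborel S = 0"
proof -
  have "measure gauss S = 0 \<longleftrightarrow> S \<in> null_sets gauss"
    using assms by (simp add: gauss.emeasure_eq_measure null_sets_def)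
  also have "\<dots> \<longleftrightarrow> (AE x\<in>S in lborel. ennreal (gauss_density x) = 0)"
    using assms unfolding gauss_def by (subst null_sets_density_iff) auto
  also have "\<dots> \<longleftrightarrow> (AE x in lborel. x \<notin> S)"
  proof -
    have "\<not> gauss_density x \<le> 0" for x :: 'a
      using gauss_density_pos[of x] by simp
    then show ?thesis by (simp add: ennreal_eq_0_iff)
  qed
  also have "\<dots> \<longleftrightarrow> emeasure lborel S = 0"
    using assms by (subst AE_iff_measurable[where N=S]) auto
  finally show ?thesis .
qed

lemma nn_integral_lborel_translate:
  fixes F :: "'a::euclidean_space \<Rightarrow> ennreal"
  assumes [measurable]: "F \<in> borel_measurable borel"
  shows "(\<integral>\<^sup>+x. F (c + x) \<partial>lborel) = (\<integral>\<^sup>+x. F x \<partial>lborel)"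
proof -
  have "(\<integral>\<^sup>+x. F x \<partial>lborel) = (\<integral>\<^sup>+x. F x \<partial>distr lborel borel ((+) c))"
    by (simp add: lborel_distr_plus)
  also have "\<dots> = (\<integral>\<^sup>+x. F (c + x) \<partial>lborel)"
    by (subst nn_integral_distr) auto
  finally show ?thesis ..
qed

text \<open>The translation only changes the coordinate along \<open>u\<close>, from
  \<open>x \<bullet> u\<close> to \<open>x \<bullet> u - r\<close>. Both sides therefore share the
  factor of the orthogonal complement, and the remaining factors agree because the normal density is
  even.\<close>

lemma gauss_density_translate:
  assumes "norm u = 1"
  shows "gauss_density (x - r *\<^sub>R u) * std_normal_density (x \<bullet> u)
    = gauss_density x * std_normal_density (r - x \<bullet> u)"
proof -
  have "(norm (x - r *\<^sub>R u))\<^sup>2 = (norm x)\<^sup>2 - 2 * r * (x \<bullet> u) + r\<^sup>2"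
    using assms unfolding power2_norm_eq_inner norm_eq_1
    by (simp add: inner_diff inner_commute algebra_simps power2_eq_square)
  then have "exp (- (norm (x - r *\<^sub>R u))\<^sup>2 / 2) * exp (- (x \<bullet> u)\<^sup>2 / 2)
      = exp (- (norm x)\<^sup>2 / 2) * exp (- (r - x \<bullet> u)\<^sup>2 / 2)"
    unfolding exp_add[symmetric] by (simp add: power2_diff field_simps)
  then show ?thesis
    by (simp add: gauss_density_norm std_normal_density_def)
qed

section \<open>Slices along a direction\<close>

text \<open>For a unit vector \<open>u\<close> this replaces the \<open>u\<close>-coordinate of
  \<open>x\<close> by \<open>s\<close>. Parametrising the line by this coordinate, and not by the
  distance from \<open>x\<close>, makes the slice of a set the same for all \<open>x\<close> on the
  line.\<close>

definition line_point :: "'a::euclidean_space \<Rightarrow> 'a \<Rightarrow> real \<Rightarrow> 'a" where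
  "line_point u x s = x + (s - x \<bullet> u) *\<^sub>R u"

lemma borel_measurable_line_point [measurable]:
  "(\<lambda>(x, s). line_point u x s) \<in> borel_measurable (borel \<Otimes>\<^sub>M borel)"
  unfolding line_point_def by measurable

lemma borel_measurable_line_point_right [measurable]: "line_point u x \<in> borel_measurable borel"
  unfolding line_point_def by measurable

lemma inner_line_point [simp]: "norm u = 1 \<Longrightarrow> line_point u x s \<bullet> u = s"
  by (simp add: line_point_def inner_add_left norm_eq_1)

lemma line_point_line_point [simp]: "norm u = 1 \<Longrightarrow> line_point u (line_point u x s) r = line_point u x r"
  by (simp add: line_point_def inner_add_left norm_eq_1 algebra_simps)

text \<open>Resampling the \<open>u\<close>-coordinate by an independent standard normal variable
  leaves the Gaussian law unchanged. This replaces an orthogonal decomposition of the space or a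
  change of basis.\<close>

lemma nn_integral_gauss_slice:
  fixes F :: "'a::euclidean_space \<Rightarrow> ennreal"
  assumes [measurable]: "F \<in> borel_measurable borel" and u: "norm u = 1"
  shows "(\<integral>\<^sup>+x. F x \<partial>gauss) = (\<integral>\<^sup>+x. \<integral>\<^sup>+s. F (line_point u x s) \<partial>std_normal_distribution \<partial>gauss)"
proof -
  have [measurable]: "(\<lambda>x. \<integral>\<^sup>+s. F (line_point u x s) \<partial>std_normal_distribution) \<in> borel_measurable borel"
    by (intro std_normal.borel_measurable_nn_integral) measurable
  have line: "(\<integral>\<^sup>+s. ennreal (std_normal_density s) * F (line_point u x s) \<partial>lborel)
      = (\<integral>\<^sup>+r. ennreal (std_normal_density (x \<bullet> u + r)) * F (x + r *\<^sub>R u) \<partial>lborel)" for x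
    by (subst nn_integral_real_affine[where c=1 and t="x \<bullet> u"]) (auto simp: line_point_def)
  have mass: "(\<integral>\<^sup>+r. ennreal (std_normal_density (r - c)) \<partial>lborel) = 1" for c
    using nn_integral_lborel_translate[of "\<lambda>r. ennreal (std_normal_density r)" "- c"]
      std_normal.emeasure_space_1 by (simp add: emeasure_density)
  have "(\<integral>\<^sup>+x. \<integral>\<^sup>+s. F (line_point u x s) \<partial>std_normal_distribution \<partial>gauss)
      = (\<integral>\<^sup>+x. ennreal (gauss_density x) *
          (\<integral>\<^sup>+s. ennreal (std_normal_density s) * F (line_point u x s) \<partial>lborel) \<partial>lborel)"
    by (subst nn_integral_gauss) (auto intro!: nn_integral_cong simp: nn_integral_density)
  also have "\<dots> = (\<integral>\<^sup>+x. ennreal (gauss_density x) *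
          (\<integral>\<^sup>+r. ennreal (std_normal_density (x \<bullet> u + r)) * F (x + r *\<^sub>R u) \<partial>lborel) \<partial>lborel)"
    by (simp add: line)
  also have "\<dots> = (\<integral>\<^sup>+x. \<integral>\<^sup>+r. ennreal (gauss_density x) *
          (ennreal (std_normal_density (x \<bullet> u + r)) * F (x + r *\<^sub>R u)) \<partial>lborel \<partial>lborel)"
    by (intro nn_integral_cong) (simp add: nn_integral_cmult)
  also have "\<dots> = (\<integral>\<^sup>+r. \<integral>\<^sup>+x. ennreal (gauss_density x) *
          (ennreal (std_normal_density (x \<bullet> u + r)) * F (x + r *\<^sub>R u)) \<partial>lborel \<partial>lborel)"
    by (rule lborel_pair.Fubini'[symmetric]) measurable
  \<comment> \<open>For fixed \<open>r\<close>, translating \<open>x\<close> by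
    \<open>- r *\<^sub>R u\<close> frees the argument of \<open>F\<close> from \<open>r\<close>; the
    density identity then leaves a factor whose integral over \<open>r\<close> is 1.\<close>
  also have "\<dots> = (\<integral>\<^sup>+r. \<integral>\<^sup>+x. ennreal (gauss_density (x - r *\<^sub>R u)) *
          (ennreal (std_normal_density (x \<bullet> u)) * F x) \<partial>lborel \<partial>lborel)"
    (is "(\<integral>\<^sup>+r. ?L r \<partial>lborel) = (\<integral>\<^sup>+r. ?R r \<partial>lborel)")
  proof (rule nn_integral_cong)
    fix r :: real
    show "?L r = ?R r"
      using u by (subst nn_integral_lborel_translate[where c="- r *\<^sub>R u", symmetric])
        (auto simp: inner_diff_left norm_eq_1)
  qed
  also have "\<dots> = (\<integral>\<^sup>+r. \<integral>\<^sup>+x. ennreal (std_normal_density (r - x \<bullet> u)) *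
          (ennreal (gauss_density x) * F x) \<partial>lborel \<partial>lborel)"
  proof (intro nn_integral_cong)
    fix r x
    have "ennreal (gauss_density (x - r *\<^sub>R u)) * ennreal (std_normal_density (x \<bullet> u))
        = ennreal (std_normal_density (r - x \<bullet> u)) * ennreal (gauss_density x)"
      using gauss_density_translate[OF u, of x r]
      by (simp add: gauss_density_pos less_imp_le mult.commute flip: ennreal_mult)
    then show "ennreal (gauss_density (x - r *\<^sub>R u)) * (ennreal (std_normal_density (x \<bullet> u)) * F x)
        = ennreal (std_normal_density (r - x \<bullet> u)) * (ennreal (gauss_density x) * F x)"
      by (simp add: mult.assoc[symmetric])
  qed
  also have "\<dots> = (\<integral>\<^sup>+x. \<integral>\<^sup>+r. ennreal (std_normal_density (r - x \<bullet> u)) *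
          (ennreal (gauss_density x) * F x) \<partial>lborel \<partial>lborel)"
    by (rule lborel_pair.Fubini') measurable
  also have "\<dots> = (\<integral>\<^sup>+x. (\<integral>\<^sup>+r. ennreal (std_normal_density (r - x \<bullet> u)) \<partial>lborel) *
          (ennreal (gauss_density x) * F x) \<partial>lborel)"
    by (intro nn_integral_cong) (simp add: nn_integral_multc)
  finally show ?thesis by (simp add: nn_integral_gauss mass)
qed

text \<open>A function on the whole space, constant along lines parallel to \<open>u\<close>, so
  that slices can be averaged with \<open>gauss\<close> itself instead of a measure on a
  hyperplane.\<close>

definition slice_mass :: "'a::euclidean_space \<Rightarrow> 'a set \<Rightarrow> 'a \<Rightarrow> real" where
  "slice_mass u A x = measure std_normal_distribution {s. line_point u x s \<in> A}"

lemma slice_mass_bounds [simp]: "0 \<le> slice_mass u A x" "slice_mass u A x \<le> 1"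
  by (auto simp: slice_mass_def)

lemma sets_slice [measurable]: "A \<in> sets borel \<Longrightarrow> {s. line_point u x s \<in> A} \<in> sets borel"
  using measurable_sets_borel[OF borel_measurable_line_point_right] by (simp add: vimage_def)

lemma ennreal_slice_mass:
  assumes [measurable]: "A \<in> sets borel"
  shows "ennreal (slice_mass u A x) = (\<integral>\<^sup>+s. indicator A (line_point u x s) \<partial>std_normal_distribution)"
proof -
  have "(\<integral>\<^sup>+s. indicator A (line_point u x s) \<partial>std_normal_distribution)
      = (\<integral>\<^sup>+s. indicator {s. line_point u x s \<in> A} s \<partial>std_normal_distribution)"
    by (intro nn_integral_cong) (auto simp: indicator_def)
  then show ?thesis
    by (simp add: slice_mass_def std_normal.emeasure_eq_measure)
qed

lemma borel_measurable_slice_mass [measurable]: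
  assumes [measurable]: "A \<in> sets borel"
  shows "slice_mass u A \<in> borel_measurable borel"
proof -
  have "(\<lambda>x. enn2real (\<integral>\<^sup>+s. indicator A (line_point u x s) \<partial>std_normal_distribution)) \<in> borel_measurable borel"
    by (intro borel_measurable_enn2real std_normal.borel_measurable_nn_integral) measurable
  also have "(\<lambda>x. enn2real (\<integral>\<^sup>+s. indicator A (line_point u x s) \<partial>std_normal_distribution)) = slice_mass u A"
    by (intro ext) (simp add: ennreal_slice_mass[symmetric] assms)
  finally show ?thesis .
qed

lemma slice_mass_line_point [simp]: "norm u = 1 \<Longrightarrow> slice_mass u A (line_point u x s) = slice_mass u A x"
  by (simp add: slice_mass_def)

lemma slice_mass_mono: "A \<subseteq> B \<Longrightarrow> B \<in> sets borel \<Longrightarrow> slice_mass u A x \<le> slice_mass u B x"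
  unfolding slice_mass_def by (intro std_normal.finite_measure_mono) auto

lemma integrable_slice_mass [simp]: "A \<in> sets borel \<Longrightarrow> integrable gauss (slice_mass u A)"
  by (intro gauss.integrable_const_bound[where B=1]) auto

lemma measure_gauss_slice:
  assumes [measurable]: "A \<in> sets borel" and u: "norm u = 1"
  shows "measure gauss A = (\<integral>x. slice_mass u A x \<partial>gauss)"
proof -
  have "emeasure gauss A = (\<integral>\<^sup>+x. indicator A x \<partial>gauss)" by simp
  also have "\<dots> = (\<integral>\<^sup>+x. ennreal (slice_mass u A x) \<partial>gauss)"
    by (subst nn_integral_gauss_slice[OF _ u]) (auto simp: ennreal_slice_mass)
  also have "\<dots> = ennreal (\<integral>x. slice_mass u A x \<partial>gauss)"
    by (intro nn_integral_eq_integral) auto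
  finally show ?thesis
    by (simp add: gauss.emeasure_eq_measure)
qed

section \<open>Ehrhard symmetrisation\<close>

lemma measure_Phi_le:
  assumes "0 \<le> p" "p \<le> 1"
  shows "measure std_normal_distribution {s. Phi s \<le> p} = p"
proof -
  consider "p = 0" | "p = 1" | z where "p = Phi z"
    using assms Phi_surj[of p] by (metis order_le_less)
  then show ?thesis
  proof cases
    case 1
    then have "{s. Phi s \<le> p} = {}" using Phi_pos by (auto simp: not_le)
    then show ?thesis using 1 by simp
  next
    case 2
    then have "{s. Phi s \<le> p} = UNIV" using Phi_less_1 by (auto intro: less_imp_le)
    then show ?thesis using 2 std_normal.prob_space by simp
  next
    case (3 z)
    then have "{s. Phi s \<le> p} = {..z}" by auto
    then show ?thesis using 3 by simp
  qed
qed

text \<open>Comparing values of \<open>Phi\<close> avoids its inverse: a slice of mass 0 becomes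
  empty and one of mass 1 the whole line, with no infinite thresholds. The half-lines extend towards
  \<open>- u\<close>.\<close>

definition symmetrize :: "'a::euclidean_space \<Rightarrow> 'a set \<Rightarrow> 'a set" where
  "symmetrize u A = {x. Phi (x \<bullet> u) \<le> slice_mass u A x}"

lemma borel_measurable_Phi [measurable]: "Phi \<in> borel_measurable borel"
  by (intro borel_measurable_continuous_onI continuous_at_imp_continuous_on ballI isCont_Phi)

lemma sets_symmetrize [measurable]:
  assumes [measurable]: "A \<in> sets borel"
  shows "symmetrize u A \<in> sets borel"
  unfolding symmetrize_def by measurable

lemma slice_symmetrize:
  "norm u = 1 \<Longrightarrow> {s. line_point u x s \<in> symmetrize u A} = {s. Phi s \<le> slice_mass u A x}"
  by (simp add: symmetrize_def)

lemma measure_symmetrize: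
  assumes "A \<in> sets borel" "norm u = 1"
  shows "measure gauss (symmetrize u A) = measure gauss A"
proof -
  have "slice_mass u (symmetrize u A) x = slice_mass u A x" for x
    using assms by (subst slice_mass_def) (simp add: slice_symmetrize measure_Phi_le)
  then show ?thesis
    using assms by (simp add: measure_gauss_slice[of _ u] sets_symmetrize)
qed

abbreviation enlarge :: "real \<Rightarrow> 'a::metric_space set \<Rightarrow> 'a set" where
  "enlarge t A \<equiv> (\<Union>x\<in>A. ball x t)"

text \<open>On a parallel line at distance \<open>norm q\<close>, a ball of radius \<open>t\<close>
  centred on the first line cuts out an interval of radius
  \<open>sqrt (t\<^sup>2 - (norm q)\<^sup>2)\<close>. The one-dimensional inequality with this
  radius compares the slice of \<open>A\<close> through \<open>x\<close> with the slice of its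
  neighbourhood through \<open>z\<close>.\<close>

lemma enlarge_symmetrize:
  assumes [measurable]: "A \<in> sets borel" and u: "norm u = 1" and "t > 0"
  shows "enlarge t (symmetrize u A) \<subseteq> symmetrize u (enlarge t A)"
proof
  fix z assume "z \<in> enlarge t (symmetrize u A)"
  then obtain x where x: "Phi (x \<bullet> u) \<le> slice_mass u A x" and "dist x z < t"
    by (auto simp: symmetrize_def)
  \<comment> \<open>Component of \<open>z - x\<close> orthogonal to \<open>u\<close>, that is, the
    displacement between the two parallel lines.\<close>
  define q where "q = (z - x) - ((z - x) \<bullet> u) *\<^sub>R u"
  define r where "r = sqrt (t\<^sup>2 - (norm q)\<^sup>2)"
  have qu: "q \<bullet> u = 0"
    using u by (simp add: q_def inner_diff_left norm_eq_1)
  have pyth: "(norm (q + c *\<^sub>R u))\<^sup>2 = (norm q)\<^sup>2 + c\<^sup>2" for c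
    using u qu unfolding power2_norm_eq_inner by (simp add: inner_add inner_commute norm_eq_1 power2_eq_square)
  have "(norm (z - x))\<^sup>2 < t\<^sup>2"
    using \<open>dist x z < t\<close> by (intro power_strict_mono) (auto simp: dist_norm norm_minus_commute)
  then have lt: "(norm q)\<^sup>2 + ((z - x) \<bullet> u)\<^sup>2 < t\<^sup>2"
    using pyth[of "(z - x) \<bullet> u"] by (simp add: q_def)
  then have "((z - x) \<bullet> u)\<^sup>2 < t\<^sup>2 - (norm q)\<^sup>2" by simp
  then have zr: "\<bar>(z - x) \<bullet> u\<bar> < r"
    unfolding r_def by (intro real_less_rsqrt) simp
  have r2: "r\<^sup>2 = t\<^sup>2 - (norm q)\<^sup>2"
    using lt zero_le_power2[of "(z - x) \<bullet> u"] unfolding r_def by (intro real_sqrt_pow2) linarith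
  have sub: "enlarge r {s. line_point u x s \<in> A} \<subseteq> {s. line_point u z s \<in> enlarge t A}"
  proof (clarsimp simp: dist_real_def)
    fix s s' assume s: "line_point u x s \<in> A" "\<bar>s - s'\<bar> < r"
    have "line_point u z s' - line_point u x s = q + (s' - s) *\<^sub>R u"
      by (simp add: line_point_def q_def algebra_simps inner_diff_left)
    then have "(dist (line_point u x s) (line_point u z s'))\<^sup>2 = (norm q)\<^sup>2 + (s' - s)\<^sup>2"
      unfolding dist_norm by (subst norm_minus_commute) (simp add: pyth)
    also have "\<dots> < (norm q)\<^sup>2 + r\<^sup>2"
      using s(2) power_strict_mono[of "\<bar>s' - s\<bar>" r 2] by (simp add: abs_minus_commute)
    finally have "(dist (line_point u x s) (line_point u z s'))\<^sup>2 < t\<^sup>2"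
      using r2 by linarith
    then have "dist (line_point u x s) (line_point u z s') < t"
      by (rule power_less_imp_less_base) (use \<open>t > 0\<close> in simp)
    then show "\<exists>x\<in>A. dist x (line_point u z s') < t" using s(1) by blast
  qed
  have meas: "{s. line_point u z s \<in> enlarge t A} \<in> sets borel"
    by (intro sets_slice borel_open open_UN) auto
  have "Phi (z \<bullet> u) \<le> Phi (x \<bullet> u + r)"
    using zr by (simp add: inner_diff_left)
  also have "\<dots> \<le> measure std_normal_distribution (enlarge r {s. line_point u x s \<in> A})"
    using x zr by (intro std_normal_isoperimetric) (auto simp: slice_mass_def)
  also have "\<dots> \<le> slice_mass u (enlarge t A) z"
    unfolding slice_mass_def by (rule std_normal.finite_measure_mono[OF sub]) (use meas in simp)
  finally show "z \<in> symmetrize u (enlarge t A)" by (simp add: symmetrize_def)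
qed

section \<open>The Gaussian isoperimetric inequality\<close>

text \<open>Sequential compactness for Kuratowski convergence: distance functions are 1-Lipschitz,
  so a diagonal subsequence that converges on a countable dense set is enough. The two conclusions
  are the upper and lower halves of the convergence to \<open>L\<close>.\<close>

lemma closed_sets_subsequence:
  fixes A :: "nat \<Rightarrow> 'a::euclidean_space set"
  assumes ne: "\<And>n. A n \<noteq> {}"
  obtains k :: "nat \<Rightarrow> nat" and L where "strict_mono k" "closed L"
    "\<forall>x. (\<exists>\<^sub>F n in sequentially. x \<in> A (k n)) \<longrightarrow> x \<in> L"
    "\<forall>x\<in>L. \<forall>t>0. \<forall>\<^sub>F n in sequentially. \<exists>a\<in>A (k n). dist x a < t"
proof -
  obtain D :: "'a set" where D: "countable D" "\<And>X. open X \<Longrightarrow> X \<noteq> {} \<Longrightarrow> \<exists>d\<in>D. d \<in> X"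
    by (rule countable_dense_setE) blast
  \<comment> \<open>Truncation at 1 supplies the bound needed for the diagonal extraction; only
    small distances matter afterwards.\<close>
  obtain k where k: "strict_mono (k::nat\<Rightarrow>nat)"
    and conv: "\<And>x. x \<in> D \<Longrightarrow> \<exists>l. (\<lambda>n. min 1 (infdist x (A (k n)))) \<longlonglongrightarrow> l"
    using function_convergent_subsequence[OF \<open>countable D\<close>, of "\<lambda>n x. min 1 (infdist x (A n))" 1]
    by (auto simp: infdist_nonneg)
  define close where "close x e \<longleftrightarrow> (\<forall>\<^sub>F n in sequentially. infdist x (A (k n)) < e)" for x e
  define L where "L = {x. \<forall>e>0. close x e}"
  have near: "x \<in> L" if ex: "\<And>e. e > 0 \<Longrightarrow> \<exists>y. dist x y < e \<and> close y e" for x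
  proof -
    have "close x e" if e: "e > 0" for e
    proof -
      obtain y where y: "dist x y < e / 2" "close y (e / 2)"
        using ex[of "e / 2"] e by auto
      from y(2) show ?thesis
        unfolding close_def
      proof eventually_elim
        case (elim n)
        then show ?case using infdist_triangle[of x "A (k n)" y] y(1) by linarith
      qed
    qed
    then show ?thesis by (simp add: L_def)
  qed
  have "closure L \<subseteq> L"
  proof
    fix x assume "x \<in> closure L"
    then show "x \<in> L"
      by (intro near) (auto simp: closure_approachable L_def dist_commute)
  qed
  then have "closed L" by (simp add: closure_subset_eq)
  moreover have "x \<in> L" if freq: "\<exists>\<^sub>F n in sequentially. x \<in> A (k n)" for x
  proof (rule near)
    fix e :: real assume "e > 0"
    \<comment> \<open>Strictly below both \<open>e\<close> and the truncation level 1, so a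
      truncated distance near \<open>d\<close> is a true distance below \<open>e\<close>.\<close>
    define d where "d = min e 1 / 2"
    have d: "d > 0" "d < min e 1" using \<open>e > 0\<close> by (auto simp: d_def)
    obtain y where y: "y \<in> D" "dist x y < d"
      using D(2)[of "ball x d"] d(1) by auto
    obtain l where l: "(\<lambda>n. min 1 (infdist y (A (k n)))) \<longlonglongrightarrow> l"
      using conv[OF y(1)] by blast
    have "l \<le> d"
    proof (rule ccontr)
      assume "\<not> l \<le> d"
      then have "\<forall>\<^sub>F n in sequentially. d < min 1 (infdist y (A (k n)))"
        using order_tendstoD(1)[OF l, of d] by simp
      with freq have "\<exists>\<^sub>F n in sequentially. x \<in> A (k n) \<and> d < min 1 (infdist y (A (k n)))"
        by (rule frequently_eventually_frequently)
      then obtain n where "x \<in> A (k n)" "d < infdist y (A (k n))"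
        by (auto dest!: frequently_ex)
      then show False
        using infdist_le[of x "A (k n)" y] y(2) by (simp add: dist_commute)
    qed
    then have "\<forall>\<^sub>F n in sequentially. min 1 (infdist y (A (k n))) < min e 1"
      using d(2) by (intro order_tendstoD(2)[OF l]) linarith
    then have "close y e"
      unfolding close_def by eventually_elim (auto split: if_splits simp: min_def)
    then show "\<exists>y. dist x y < e \<and> close y e"
      using y d by (intro exI[of _ y]) auto
  qed
  moreover have "\<forall>\<^sub>F n in sequentially. \<exists>a\<in>A (k n). dist x a < t" if "x \<in> L" "t > 0" for x t
  proof -
    have "\<forall>\<^sub>F n in sequentially. infdist x (A (k n)) < t"
      using that by (auto simp: L_def close_def)
    then show ?thesis
    proof eventually_elim
      case (elim n)
      then show ?case
        using ne[of "k n"] by (simp add: infdist_notempty cINF_less_iff bdd_belowI2[of _ 0])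
    qed
  qed
  ultimately show ?thesis using that k by blast
qed

context finite_measure
begin

text \<open>Reverse Fatou lemma for sets. The bound \<open>c n\<close> may vary because the overlap
  of a maximising sequence only tends to its supremum.\<close>

lemma measure_frequently_ge:
  assumes [measurable]: "\<And>n. B n \<in> sets M" "L \<in> sets M"
    and ge: "\<And>n. c n \<le> measure M (B n)" and c: "c \<longlonglongrightarrow> c0"
    and L: "\<And>x. \<exists>\<^sub>F n in sequentially. x \<in> B n \<Longrightarrow> x \<in> L"
  shows "c0 \<le> measure M L"
proof -
  define U where "U m = (\<Union>n\<in>{m..}. B n)" for m
  have lim: "(\<lambda>m. measure M (U m)) \<longlonglongrightarrow> measure M (\<Inter>m. U m)"
  proof (rule finite_Lim_measure_decseq)
    show "decseq U" unfolding U_def decseq_def by (intro allI impI UN_mono) auto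
  qed (auto simp: U_def)
  have "c m \<le> measure M (U m)" for m
    using ge[of m] by (rule order_trans) (auto intro!: finite_measure_mono simp: U_def)
  then have "c0 \<le> measure M (\<Inter>m. U m)"
    using lim c by (intro LIMSEQ_le[OF c lim]) auto
  also have "\<dots> \<le> measure M L"
    using L by (intro finite_measure_mono) (auto simp: U_def frequently_sequentially Bex_def)
  finally show ?thesis .
qed

text \<open>Fatou lemma for sets; it carries the bound on neighbourhoods over to the limit
  set.\<close>

lemma measure_eventually_le:
  assumes [measurable]: "\<And>n. B n \<in> sets M"
    and le: "\<And>n. measure M (B n) \<le> c"
    and L: "\<And>x. x \<in> L \<Longrightarrow> \<forall>\<^sub>F n in sequentially. x \<in> B n"
  shows "measure M L \<le> c"
proof -
  define U where "U m = (\<Inter>n\<in>{m..}. B n)" for m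
  have lim: "(\<lambda>m. measure M (U m)) \<longlonglongrightarrow> measure M (\<Union>m. U m)"
    by (rule finite_Lim_measure_incseq) (auto simp: U_def incseq_def)
  have "measure M (U m) \<le> c" for m
    using le[of m] by (rule order_trans[rotated]) (auto intro!: finite_measure_mono simp: U_def)
  then have "measure M (\<Union>m. U m) \<le> c"
    using lim by (intro LIMSEQ_le_const2[OF lim]) auto
  moreover have "measure M L \<le> measure M (\<Union>m. U m)"
  proof (rule finite_measure_mono)
    show "L \<subseteq> (\<Union>m. U m)"
    proof
      fix x assume "x \<in> L"
      then obtain N where "\<And>n. n \<ge> N \<Longrightarrow> x \<in> B n"
        using L by (auto simp: eventually_sequentially)
      then show "x \<in> (\<Union>m. U m)" by (intro UN_I[of N]) (auto simp: U_def)
    qed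
    show "(\<Union>m. U m) \<in> sets M" by (auto simp: U_def)
  qed
  ultimately show ?thesis by linarith
qed

end

section \<open>Strict gain of overlap with a half-space\<close>

text \<open>By Fubini the overlaps integrate over all translations \<open>w\<close> to the product
  of the two Lebesgue measures, which is not 0.\<close>

lemma positive_translate_overlap:
  fixes P Q :: "'a::euclidean_space set"
  assumes [measurable]: "P \<in> sets borel" "Q \<in> sets borel"
    and P: "emeasure lborel P \<noteq> 0" and Q: "emeasure lborel Q \<noteq> 0"
  obtains w where "emeasure lborel {x\<in>P. x + w \<in> Q} \<noteq> 0"
proof -
  have "(\<integral>\<^sup>+w. \<integral>\<^sup>+x. indicator P x * indicator Q (x + w) \<partial>lborel \<partial>lborel)
      = (\<integral>\<^sup>+x. \<integral>\<^sup>+w. indicator P x * indicator Q (x + w :: 'a) \<partial>lborel \<partial>lborel :: ennreal)"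
    by (rule lborel_pair.Fubini') measurable
  also have "\<dots> = (\<integral>\<^sup>+x. indicator P x * emeasure lborel Q \<partial>lborel)"
    by (intro nn_integral_cong) (simp add: nn_integral_cmult nn_integral_lborel_translate)
  also have "\<dots> = emeasure lborel P * emeasure lborel Q"
    by (simp add: nn_integral_multc)
  also have "\<dots> \<noteq> 0" using P Q by simp
  finally have "\<exists>w. (\<integral>\<^sup>+x. indicator P x * indicator Q (x + w) \<partial>lborel :: ennreal) \<noteq> 0"
    by (rule contrapos_np) simp
  then obtain w where w: "(\<integral>\<^sup>+x. indicator P x * indicator Q (x + w) \<partial>lborel :: ennreal) \<noteq> 0" ..
  have "(\<integral>\<^sup>+x. indicator P x * indicator Q (x + w) \<partial>lborel :: ennreal)
      = (\<integral>\<^sup>+x. indicator {x\<in>P. x + w \<in> Q} x \<partial>lborel)"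
    by (intro nn_integral_cong) (auto simp: indicator_def)
  also have "\<dots> = emeasure lborel {x\<in>P. x + w \<in> Q}"
    by (rule nn_integral_indicator) measurable
  finally show ?thesis using w that by auto
qed

text \<open>Since \<open>u \<bullet> e > 0\<close>, the slices of both sets are initial segments of
  the same line. They are nested up to end points, so the intersection has the smaller of the two
  masses.\<close>

lemma slice_mass_symmetrize_Int_halfspace:
  fixes e u :: "'a::euclidean_space" and z :: real
  assumes [measurable]: "B \<in> sets borel" and u: "norm u = 1" "u \<bullet> e > 0"
  defines "H \<equiv> {x. x \<bullet> e < z}"
  shows "slice_mass u (symmetrize u B \<inter> H) x = min (slice_mass u B x) (slice_mass u H x)"
proof -
  define h where "h = (z - (x - (x \<bullet> u) *\<^sub>R u) \<bullet> e) / (u \<bullet> e)"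
  define p where "p = slice_mass u B x"
  have Hs: "line_point u x s \<in> H \<longleftrightarrow> s < h" for s
  proof -
    have "line_point u x s \<bullet> e = (x - (x \<bullet> u) *\<^sub>R u) \<bullet> e + s * (u \<bullet> e)"
      by (simp add: line_point_def inner_add_left inner_diff_left algebra_simps)
    then show ?thesis
      unfolding h_def pos_less_divide_eq[OF u(2)] H_def mem_Collect_eq by linarith
  qed
  then have H: "slice_mass u H x = Phi h" by (simp add: slice_mass_def flip: lessThan_def)
  have "{s. line_point u x s \<in> symmetrize u B \<inter> H} = {s. Phi s \<le> p} \<inter> {..<h}"
    using Hs u(1) by (auto simp: symmetrize_def p_def)
  moreover have "measure std_normal_distribution ({s. Phi s \<le> p} \<inter> {..<h}) = min p (Phi h)"
  proof (cases "p < Phi h")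
    case True
    then have "s < h" if "Phi s \<le> p" for s
      using that by (subst Phi_less_iff[symmetric]) linarith
    then have "{s. Phi s \<le> p} \<inter> {..<h} = {s. Phi s \<le> p}" by auto
    then show ?thesis using True by (simp add: p_def measure_Phi_le)
  next
    case False
    then have "Phi s \<le> p" if "s < h" for s
      using Phi_strict_mono[OF that] by linarith
    then have "{s. Phi s \<le> p} \<inter> {..<h} = {..<h}" by auto
    then show ?thesis using False by simp
  qed
  ultimately show ?thesis by (simp add: slice_mass_def[of u "_ \<inter> _"] H p_def)
qed

lemma slice_mass_split:
  assumes [measurable]: "A \<in> sets borel" "B \<in> sets borel"
  shows "slice_mass u A x = slice_mass u (A \<inter> B) x + slice_mass u (A - B) x"
proof -
  have "{s. line_point u x s \<in> A} = {s. line_point u x s \<in> A \<inter> B} \<union> {s. line_point u x s \<in> A - B}" by auto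
  then show ?thesis
    unfolding slice_mass_def
    by (subst std_normal.finite_measure_Union[symmetric]) (auto simp del: Int_iff Diff_iff intro: sets_slice)
qed

text \<open>The direction joins a point of \<open>B\<close> outside the half-space to a point of the half-space
  outside \<open>B\<close>; along such lines the half-line replacing a slice of \<open>B\<close> overlaps the
  half-space in a strictly larger portion.\<close>

lemma symmetrize_improves_overlap:
  fixes e :: "'a::euclidean_space" and z :: real
  assumes [measurable]: "B \<in> sets borel"
  defines "H \<equiv> {x. x \<bullet> e < z}"
  assumes P: "measure gauss (B - H) \<noteq> 0" and Q: "measure gauss (H - B) \<noteq> 0"
  obtains u where "norm u = 1" "measure gauss (B \<inter> H) < measure gauss (symmetrize u B \<inter> H)"
proof -
  have [measurable]: "H \<in> sets borel" by (simp add: H_def)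
  obtain w where w: "emeasure lborel {x\<in>B - H. x + w \<in> H - B} \<noteq> 0"
    using positive_translate_overlap[of "B - H" "H - B"] P Q by (auto simp: gauss_null_iff)
  define D where "D = {x\<in>B - H. x + w \<in> H - B}"
  have [measurable]: "D \<in> sets borel" unfolding D_def by measurable
  have D: "measure gauss D \<noteq> 0"
    using w unfolding D_def[symmetric] by (simp add: gauss_null_iff)
  \<comment> \<open>A single point fixes the sign: \<open>x\<close> lies outside \<open>H\<close>
    and \<open>x + w\<close> inside.\<close>
  then obtain x where "x \<in> D" by (metis ex_in_conv measure_empty)
  then have we: "w \<bullet> e < 0" by (auto simp: D_def H_def inner_add_left)
  \<comment> \<open>Symmetrised slices extend towards \<open>- u\<close>, so this orientation makes
    them extend in the direction of \<open>w\<close>, into \<open>H\<close>.\<close>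
  define u where "u = - (1 / norm w) *\<^sub>R w"
  have "w \<noteq> 0" using we by auto
  then have u: "norm u = 1" "u \<bullet> e > 0" and wu: "w = - norm w *\<^sub>R u"
    using we by (auto simp: u_def divide_neg_pos)
  \<comment> \<open>The gain of overlap on the slice through \<open>x\<close>. It is positive
    exactly when both \<open>B - H\<close> and \<open>H - B\<close> have positive mass on that
    slice.\<close>
  define g where "g x = min (slice_mass u B x) (slice_mass u H x) - slice_mass u (B \<inter> H) x" for x
  have B: "slice_mass u B x = slice_mass u (B \<inter> H) x + slice_mass u (B - H) x" for x
    by (rule slice_mass_split) measurable
  have H: "slice_mass u H x = slice_mass u (B \<inter> H) x + slice_mass u (H - B) x" for x
    by (subst slice_mass_split[of H B]) (auto simp: Int_commute)
  have g_eq: "g x = min (slice_mass u (B - H) x) (slice_mass u (H - B) x)" for x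
    by (simp add: g_def B H min_def)
  have g0: "0 \<le> g x" for x by (simp add: g_eq)
  have gD: "slice_mass u D x = 0" if "g x = 0" for x
  proof -
    have "slice_mass u (B - H) x = 0 \<or> slice_mass u (H - B) x = 0"
      using that by (auto simp: g_eq min_def split: if_splits)
    then show ?thesis
    proof
      assume "slice_mass u (B - H) x = 0"
      moreover have "slice_mass u D x \<le> slice_mass u (B - H) x"
        by (rule slice_mass_mono) (auto simp: D_def)
      ultimately show ?thesis by (simp add: order_antisym)
    next
      assume "slice_mass u (H - B) x = 0"
      \<comment> \<open>Moving along \<open>w\<close> stays on the same line, so the slice of
        \<open>D\<close> lies in a translate of the null set \<open>S\<close>. Lebesgue measure is
        used here because its null sets are visibly translation invariant.\<close>
      define S where "S = {s. line_point u x s \<in> H - B}"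
      have [measurable]: "S \<in> sets borel" unfolding S_def by (rule sets_slice) measurable
      have "emeasure lborel S = 0"
        using \<open>slice_mass u (H - B) x = 0\<close>
        unfolding slice_mass_def S_def[symmetric] by (simp add: std_normal_null_iff)
      then have "emeasure lborel {s. - norm w + s \<in> S} = 0"
        using nn_integral_lborel_translate[of "indicator S" "- norm w"]
        by (simp add: indicator_def[abs_def] flip: nn_integral_indicator)
      moreover have "{s. line_point u x s \<in> D} \<subseteq> {s. - norm w + s \<in> S}"
      proof
        fix s assume "s \<in> {s. line_point u x s \<in> D}"
        then have "line_point u x s + w \<in> H - B" by (auto simp: D_def)
        also have "line_point u x s + w = line_point u x (- norm w + s)"
          by (subst wu) (simp add: line_point_def algebra_simps)
        finally show "s \<in> {s. - norm w + s \<in> S}" by (simp add: S_def)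
      qed
      moreover have "{s. - norm w + s \<in> S} \<in> sets lborel" by measurable
      ultimately have "emeasure lborel {s. line_point u x s \<in> D} = 0"
        by (blast intro: emeasure_eq_0)
      then show ?thesis
        using std_normal_null_iff[OF sets_slice[of D u x]] by (simp add: slice_mass_def)
    qed
  qed
  have [simp]: "integrable gauss g"
    unfolding g_def
    by (intro Bochner_Integration.integrable_diff integrable_min integrable_slice_mass) measurable
  have "(\<integral>x. g x \<partial>gauss) \<noteq> 0"
  proof
    assume "(\<integral>x. g x \<partial>gauss) = 0"
    then have "AE x in gauss. g x = 0"
      using integral_nonneg_eq_0_iff_AE[of gauss g] g0 by simp
    then have "AE x in gauss. slice_mass u D x = 0"
      by eventually_elim (rule gD)
    then have "measure gauss D = 0"
      using measure_gauss_slice[of D u] u(1) by (simp add: integral_eq_zero_AE)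
    then show False using D by simp
  qed
  moreover have "0 \<le> (\<integral>x. g x \<partial>gauss)" using g0 by simp
  moreover have "(\<integral>x. g x \<partial>gauss) = measure gauss (symmetrize u B \<inter> H) - measure gauss (B \<inter> H)"
  proof -
    have "g x = slice_mass u (symmetrize u B \<inter> H) x - slice_mass u (B \<inter> H) x" for x
      using slice_mass_symmetrize_Int_halfspace[OF assms(1) u, of z x] by (simp add: g_def H_def)
    then show ?thesis
      using measure_gauss_slice[of "symmetrize u B \<inter> H" u] measure_gauss_slice[of "B \<inter> H" u] u(1)
      by (simp add: sets_symmetrize)
  qed
  ultimately show ?thesis using that[OF u(1)] by simp
qed

section \<open>The extremal set\<close>

lemma measure_gauss_open_halfspace:
  assumes "norm e = 1"
  shows "measure gauss {x. x \<bullet> e < z} = Phi z"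
proof -
  have "slice_mass e {x. x \<bullet> e < z} = (\<lambda>_. Phi z)"
    using assms by (intro ext) (simp add: slice_mass_def flip: lessThan_def)
  then show ?thesis
    using assms by (subst measure_gauss_slice[of _ e]) (auto simp: gauss.prob_space[simplified])
qed

text \<open>The slack \<open>t - dist x y\<close> of an open ball absorbs the approximation of
  \<open>x\<close> by points of \<open>A\<close>. Hence competitors may be replaced by their
  closures at no cost.\<close>

lemma enlarge_closure:
  assumes "t > 0" shows "enlarge t (closure A) = enlarge t A"
proof
  show "enlarge t A \<subseteq> enlarge t (closure A)"
    using closure_subset[of A] by blast
  show "enlarge t (closure A) \<subseteq> enlarge t A"
  proof clarsimp
    fix x y assume "x \<in> closure A" "dist x y < t"
    then obtain a where "a \<in> A" "dist a x < t - dist x y"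
      by (meson closure_approachable diff_gt_0_iff_gt)
    then show "\<exists>x\<in>A. dist x y < t"
      using dist_triangle[of a y x] by (intro bexI[of _ a]) auto
  qed
qed

theorem gauss_isoperimetric:
  fixes A :: "'a::euclidean_space set"
  assumes [measurable]: "A \<in> sets borel" and t: "t > 0" and z: "Phi z \<le> measure gauss A"
  shows "Phi (z + t) \<le> measure gauss (enlarge t A)"
proof (rule ccontr)
  define c where "c = measure gauss (enlarge t A)"
  assume "\<not> Phi (z + t) \<le> measure gauss (enlarge t A)"
  then have c: "c < Phi (z + t)" by (simp add: c_def)
  obtain e :: 'a where e: "norm e = 1" using SOME_Basis norm_Basis by blast
  define H where "H = {x. x \<bullet> e < z}"
  have [measurable]: "H \<in> sets borel" by (simp add: H_def)
  have mH: "measure gauss H = Phi z" using e by (simp add: H_def measure_gauss_open_halfspace)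
  \<comment> \<open>Keeping the bound \<open>c\<close> fixed makes the class stable under
    symmetrisation followed by closure, and under the limits just constructed.\<close>
  define admissible where "admissible B \<longleftrightarrow> closed B \<and> Phi z \<le> measure gauss B \<and>
    measure gauss (enlarge t B) \<le> c" for B :: "'a set"
  have adm_closure: "admissible (closure B)"
    if "B \<in> sets borel" "Phi z \<le> measure gauss B" "measure gauss (enlarge t B) \<le> c" for B
  proof -
    have "measure gauss B \<le> measure gauss (closure B)"
      by (intro gauss.finite_measure_mono closure_subset) auto
    then show ?thesis
      using that enlarge_closure[OF t, of B] by (simp add: admissible_def)
  qed
  define V where "V = (\<lambda>B. measure gauss (B \<inter> H)) ` {B. admissible B}"
  have "admissible (closure A)" using z by (intro adm_closure) (auto simp: c_def)
  then have "V \<noteq> {}" by (auto simp: V_def)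
  have "bdd_above V" by (auto simp: V_def bdd_above_def intro!: exI[of _ 1])
  have "\<exists>B. admissible B \<and> Sup V - 1 / real (Suc n) \<le> measure gauss (B \<inter> H)" for n
    using less_cSupD[OF \<open>V \<noteq> {}\<close>, of "Sup V - 1 / real (Suc n)"] by (auto simp: V_def less_imp_le)
  then obtain B where B: "\<And>n. admissible (B n)"
    "\<And>n. Sup V - 1 / real (Suc n) \<le> measure gauss (B n \<inter> H)" by metis
  have "B n \<noteq> {}" for n
    using B(1)[of n] Phi_pos[of z] by (auto simp: admissible_def)
  then obtain k :: "nat \<Rightarrow> nat" and L where k: "strict_mono k" and "closed L"
    and freq: "\<forall>x. (\<exists>\<^sub>F n in sequentially. x \<in> B (k n)) \<longrightarrow> x \<in> L"
    and ev: "\<forall>x\<in>L. \<forall>t>0. \<forall>\<^sub>F n in sequentially. \<exists>a\<in>B (k n). dist x a < t"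
    by (rule closed_sets_subsequence)
  have [measurable]: "\<And>n. B n \<in> sets borel" "L \<in> sets borel"
    using B(1) \<open>closed L\<close> by (auto simp: admissible_def borel_closed)
  have L1: "Phi z \<le> measure gauss L"
    by (rule gauss.measure_frequently_ge[where B="\<lambda>n. B (k n)" and c="\<lambda>_. Phi z"])
      (use B(1) freq in \<open>simp_all add: admissible_def\<close>)
  have "(\<lambda>n. Sup V - 1 / real (Suc n)) \<longlonglongrightarrow> Sup V - 0"
    by (intro tendsto_intros LIMSEQ_inverse_real_of_nat[unfolded inverse_eq_divide])
  then have lim: "(\<lambda>n. Sup V - 1 / real (Suc (k n))) \<longlonglongrightarrow> Sup V"
    using LIMSEQ_subseq_LIMSEQ[OF _ k, of "\<lambda>n. Sup V - 1 / real (Suc n)"] by (simp add: o_def)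
  have L2: "Sup V \<le> measure gauss (L \<inter> H)"
  proof (rule gauss.measure_frequently_ge[where B="\<lambda>n. B (k n) \<inter> H", OF _ _ _ lim])
    show "Sup V - 1 / real (Suc (k n)) \<le> measure gauss (B (k n) \<inter> H)" for n
      by (rule B(2))
    fix x assume "\<exists>\<^sub>F n in sequentially. x \<in> B (k n) \<inter> H"
    then show "x \<in> L \<inter> H"
      using freq by (auto dest: frequently_ex elim: frequently_elim1)
  qed measurable
  have L3: "measure gauss (enlarge t L) \<le> c"
  proof (rule gauss.measure_eventually_le[where B="\<lambda>n. enlarge t (B (k n))"])
    fix y assume "y \<in> enlarge t L"
    \<comment> \<open>The strict inequality leaves room \<open>t - dist x y\<close> for replacing
      \<open>x\<close> by a nearby point of \<open>B (k n)\<close>.\<close>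
    then obtain x where x: "x \<in> L" "dist x y < t" by auto
    have "\<forall>\<^sub>F n in sequentially. \<exists>a\<in>B (k n). dist x a < t - dist x y"
      using x ev by simp
    then show "\<forall>\<^sub>F n in sequentially. y \<in> enlarge t (B (k n))"
    proof eventually_elim
      case (elim n)
      then obtain a where "a \<in> B (k n)" "dist x a < t - dist x y" by blast
      then show ?case
        using dist_triangle[of a y x] by (auto simp: dist_commute intro!: bexI[of _ a])
    qed
  next
    show "enlarge t (B (k n)) \<in> sets gauss" "measure gauss (enlarge t (B (k n))) \<le> c" for n
      using B(1) by (auto simp: admissible_def intro!: borel_open)
  qed
  have "measure gauss (H - L) = 0"
  proof (rule ccontr)
    assume Q: "measure gauss (H - L) \<noteq> 0"
    \<comment> \<open>\<open>L\<close> has at least the mass of \<open>H\<close>, so whatever it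
      misses of \<open>H\<close> is compensated outside \<open>H\<close>. Both differences are then
      non-null, as the strict gain requires.\<close>
    have "measure gauss H = measure gauss (H \<inter> L) + measure gauss (H - L)"
      "measure gauss L = measure gauss (H \<inter> L) + measure gauss (L - H)"
      using gauss.finite_measure_Diff'[of H L] gauss.finite_measure_Diff'[of L H] by (auto simp: Int_commute)
    then have "measure gauss (L - H) \<noteq> 0"
      using Q L1 mH measure_nonneg[of gauss "H - L"] by linarith
    then obtain u where u: "norm u = 1" "measure gauss (L \<inter> H) < measure gauss (symmetrize u L \<inter> H)"
      using symmetrize_improves_overlap[of L e z] Q by (auto simp: H_def)
    have [measurable]: "enlarge t L \<in> sets borel" by (intro borel_open open_UN) auto
    have "symmetrize u (enlarge t L) \<in> sets gauss" unfolding sets_gauss by (rule sets_symmetrize) fact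
    then have "measure gauss (enlarge t (symmetrize u L)) \<le> measure gauss (symmetrize u (enlarge t L))"
      using enlarge_symmetrize[of L u t] u t by (intro gauss.finite_measure_mono) auto
    also have "\<dots> = measure gauss (enlarge t L)"
      by (intro measure_symmetrize u borel_open) auto
    finally have "admissible (closure (symmetrize u L))"
      using L1 L3 u by (intro adm_closure) (auto simp: measure_symmetrize intro!: sets_symmetrize)
    then have "measure gauss (closure (symmetrize u L) \<inter> H) \<le> Sup V"
      by (intro cSup_upper \<open>bdd_above V\<close>) (auto simp: V_def)
    moreover have "measure gauss (symmetrize u L \<inter> H) \<le> measure gauss (closure (symmetrize u L) \<inter> H)"
      using closure_subset[of "symmetrize u L"] by (intro gauss.finite_measure_mono) auto
    ultimately show False using u(2) L2 by linarith
  qed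
  then have null: "emeasure lborel (H - L) = 0" by (simp add: gauss_null_iff)
  \<comment> \<open>\<open>H - L\<close> is open as well as null, hence empty.\<close>
  have "H \<subseteq> L"
  proof (rule ccontr)
    assume "\<not> H \<subseteq> L"
    then obtain x where x: "x \<in> H - L" by blast
    have "open (H - L)"
      using \<open>closed L\<close> by (auto simp: H_def open_halfspace_component_lt intro!: open_Diff open_Collect_less continuous_intros)
    then obtain r where r: "r > 0" "ball x r \<subseteq> H - L" using x open_contains_ball by blast
    have "emeasure lborel (ball x r) \<le> emeasure lborel (H - L)"
      using r by (intro emeasure_mono) auto
    then have "measure lborel (ball x r) = 0" using null by (simp add: measure_def)
    then show False using content_ball_pos[OF r(1), of x] by simp
  qed
  have "{x. x \<bullet> e < z + t} \<subseteq> enlarge t L"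
  proof
    fix y assume "y \<in> {x. x \<bullet> e < z + t}"
    \<comment> \<open>Moving \<open>y\<close> back by \<open>s < t\<close> along \<open>e\<close>
      lands in \<open>H\<close>.\<close>
    then obtain s where s: "max 0 (y \<bullet> e - z) < s" "s < t"
      using t dense[of "max 0 (y \<bullet> e - z)" t] by auto
    have "(y - s *\<^sub>R e) \<bullet> e < z" using s e by (simp add: inner_diff_left norm_eq_1)
    then have "y - s *\<^sub>R e \<in> L" using \<open>H \<subseteq> L\<close> by (auto simp: H_def)
    moreover have "y \<in> ball (y - s *\<^sub>R e) t" using s e by (simp add: dist_norm)
    ultimately show "y \<in> enlarge t L" by blast
  qed
  then have "measure gauss {x. x \<bullet> e < z + t} \<le> measure gauss (enlarge t L)"
    by (intro gauss.finite_measure_mono) (auto intro!: borel_open)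
  then show False using L3 c e by (simp add: measure_gauss_open_halfspace)
qed

section \<open>Concentration for penalized least squares\<close>

text \<open>The sublevel set at \<open>R\<close> has mass at least \<open>Phi 0\<close>, and on its
  \<open>t\<close>-neighbourhood \<open>h\<close> exceeds \<open>R\<close> by at most
  \<open>L * t\<close>.\<close>

lemma gauss_lipschitz_concentration:
  fixes h :: "'a::euclidean_space \<Rightarrow> real"
  assumes lip: "\<And>x y. \<bar>h x - h y\<bar> \<le> L * dist x y" and "L > 0"
    and half: "1 / 2 \<le> measure gauss {x. h x \<le> R}" and t: "t > 0"
  shows "Phi t \<le> measure gauss {x. h x \<le> R + L * t}"
proof -
  have "L-lipschitz_on UNIV h"
    using assms by (intro lipschitz_onI) (auto simp: dist_real_def)
  then have cont: "continuous_on UNIV h" by (rule lipschitz_on_continuous_on)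
  then have [measurable]: "h \<in> borel_measurable borel" by (rule borel_measurable_continuous_onI)
  define A where "A = {x. h x \<le> R}"
  have "A \<in> sets borel" unfolding A_def by measurable
  then have "Phi (0 + t) \<le> measure gauss (enlarge t A)"
    using half t by (intro gauss_isoperimetric) (auto simp: Phi_0 A_def)
  also have "\<dots> \<le> measure gauss {x. h x \<le> R + L * t}"
  proof (rule gauss.finite_measure_mono)
    show "enlarge t A \<subseteq> {x. h x \<le> R + L * t}"
    proof clarsimp
      fix x y assume "x \<in> A" "dist x y < t"
      then have "L * dist x y \<le> L * t" using \<open>L > 0\<close> by simp
      then show "h y \<le> R + L * t" using lip[of x y] \<open>x \<in> A\<close> by (auto simp: A_def)
    qed
    show "{x. h x \<le> R + L * t} \<in> sets gauss" unfolding sets_gauss by measurable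
  qed
  finally show ?thesis by simp
qed

text \<open>The half-line \<open>{..- t}\<close> is a shift of \<open>{..0}\<close> by
  \<open>t\<close>, at the cost of a factor at most \<open>exp (- t\<^sup>2 / 2)\<close>. The choice
  \<open>t = sqrt (2 * x)\<close> turns this factor into \<open>exp (- x)\<close>.\<close>

lemma Phi_ge_exp:
  assumes "x > 0" shows "1 - exp (- x) \<le> Phi (sqrt (2 * x))"
proof -
  define t where "t = sqrt (2 * x)"
  have "t \<ge> 0" and t2: "t\<^sup>2 = 2 * x" using assms by (auto simp: t_def)
  have "{x. x + t \<in> {..0::real}} = {..- t}" by auto
  then have "Phi (- t) \<le> exp (- x) * Phi 0"
    using std_normal_shift_le[of "{..0}" t 0] \<open>t \<ge> 0\<close> by (simp add: t2)
  also have "\<dots> \<le> exp (- x)" by (simp add: Phi_0)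
  finally show ?thesis by (simp add: Phi_minus t_def)
qed

text \<open>Fubini on the region below the graph. As \<open>ennreal\<close> sends negative reals to
  0, the left side is the integral of the positive part.\<close>

lemma (in sigma_finite_measure) nn_integral_layer_cake:
  fixes u :: "'a \<Rightarrow> real"
  assumes [measurable]: "u \<in> borel_measurable M"
  shows "(\<integral>\<^sup>+x. ennreal (u x) \<partial>M)
    = (\<integral>\<^sup>+t. indicator {0<..} t * emeasure M {x\<in>space M. t < u x} \<partial>lborel)"
proof -
  interpret pair_sigma_finite lborel M ..
  have "(\<integral>\<^sup>+x. ennreal (u x) \<partial>M)
      = (\<integral>\<^sup>+x. \<integral>\<^sup>+t. indicator {0<..} t * (if t < u x then 1 else 0) \<partial>lborel \<partial>M)"
  proof (intro nn_integral_cong)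
    fix x
    have "(\<integral>\<^sup>+t. indicator {0<..} t * (if t < u x then 1 else 0) \<partial>lborel)
        = (\<integral>\<^sup>+t. indicator {0<..<u x} t \<partial>lborel :: ennreal)"
      by (intro nn_integral_cong) (auto simp: indicator_def)
    also have "\<dots> = ennreal (u x)"
      by (cases "0 \<le> u x") (auto simp: ennreal_neg)
    finally show "ennreal (u x) = (\<integral>\<^sup>+t. indicator {0<..} t * (if t < u x then 1 else 0) \<partial>lborel)" ..
  qed
  also have "\<dots> = (\<integral>\<^sup>+t. \<integral>\<^sup>+x. indicator {0<..} t * (if t < u x then 1 else 0) \<partial>M \<partial>lborel)"
    by (rule Fubini') measurable
  also have "\<dots> = (\<integral>\<^sup>+t. indicator {0<..} t * emeasure M {x\<in>space M. t < u x} \<partial>lborel)"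
  proof (intro nn_integral_cong)
    fix t :: real
    have "(\<integral>\<^sup>+x. indicator {0<..} t * (if t < u x then 1 else 0) \<partial>M)
        = (\<integral>\<^sup>+x. indicator {0<..} t * indicator {x\<in>space M. t < u x} x \<partial>M)"
      by (intro nn_integral_cong) (auto simp: indicator_def)
    then show "(\<integral>\<^sup>+x. indicator {0<..} t * (if t < u x then 1 else 0) \<partial>M)
        = indicator {0<..} t * emeasure M {x\<in>space M. t < u x}"
      by (simp add: nn_integral_cmult)
  qed
  finally show ?thesis .
qed

text \<open>The positive part is half of \<open>\<bar>x\<bar> + x\<close>; the first absolute moment
  is \<open>sqrt (2 / pi)\<close> and the mean is 0.\<close>

lemma nn_integral_std_normal_positive_part:
  "(\<integral>\<^sup>+s. ennreal s \<partial>std_normal_distribution) = ennreal (1 / sqrt (2 * pi))"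
proof -
  have *: "has_bochner_integral lborel (\<lambda>x. (1 / 2) * (std_normal_density x * \<bar>x\<bar> + std_normal_density x * x))
      ((1 / 2) * (sqrt (2 / pi) + 0))"
    using std_normal_moment_abs_odd[of 0] std_normal_moment_odd[of 0]
    by (intro has_bochner_integral_mult_right has_bochner_integral_add) auto
  have "(\<integral>\<^sup>+s. ennreal s \<partial>std_normal_distribution)
      = (\<integral>\<^sup>+x. ennreal ((1 / 2) * (std_normal_density x * \<bar>x\<bar> + std_normal_density x * x)) \<partial>lborel)"
  proof (subst nn_integral_density)
    show "(\<integral>\<^sup>+x. ennreal (std_normal_density x) * ennreal x \<partial>lborel)
      = (\<integral>\<^sup>+x. ennreal ((1 / 2) * (std_normal_density x * \<bar>x\<bar> + std_normal_density x * x)) \<partial>lborel)"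
    proof (intro nn_integral_cong)
      fix x :: real
      show "ennreal (std_normal_density x) * ennreal x
          = ennreal ((1 / 2) * (std_normal_density x * \<bar>x\<bar> + std_normal_density x * x))"
        by (cases "x \<ge> 0") (auto simp: ennreal_neg simp flip: ennreal_mult)
    qed
  qed auto
  also have "\<dots> = ennreal ((1 / 2) * (sqrt (2 / pi) + 0))"
    using * by (subst nn_integral_eq_integral)
      (auto simp: has_bochner_integral_iff abs_if distrib_left[symmetric])
  also have "(1 / 2) * (sqrt (2 / pi) + 0) = 1 / sqrt (2 * pi)"
    by (simp add: real_sqrt_divide real_sqrt_mult field_simps)
  finally show ?thesis .
qed

text \<open>At every positive level the tail of \<open>(h - R) / L\<close> is at most that of a
  standard normal variable, so by the layer cake formula its positive part has at most the normal
  mean.\<close>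

lemma (in prob_space) expectation_le_gaussian_tail:
  fixes h :: "'a \<Rightarrow> real"
  assumes [measurable]: "h \<in> borel_measurable M" and h0: "\<And>x. 0 \<le> h x" and "L > 0"
    and tail: "\<And>t. t > 0 \<Longrightarrow> Phi t \<le> prob {x\<in>space M. h x \<le> R + L * t}"
  shows "integrable M h" "expectation h \<le> R + L / sqrt (2 * pi)"
proof -
  define u where "u x = (h x - R) / L" for x
  have [measurable]: "u \<in> borel_measurable M" unfolding u_def by measurable
  have "(\<integral>\<^sup>+x. ennreal (u x) \<partial>M)
      = (\<integral>\<^sup>+t. indicator {0<..} t * emeasure M {x\<in>space M. t < u x} \<partial>lborel)"
    by (rule nn_integral_layer_cake) measurable
  also have "\<dots> \<le> (\<integral>\<^sup>+t. indicator {0<..} t * emeasure std_normal_distribution {s. t < s} \<partial>lborel)"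
  proof (intro nn_integral_mono)
    fix t :: real
    have "emeasure M {x\<in>space M. t < u x} \<le> emeasure std_normal_distribution {s. t < s}" if "t > 0"
    proof -
      have "prob {x\<in>space M. t < u x} = 1 - prob {x\<in>space M. u x \<le> t}"
        using prob_neg[of "\<lambda>x. u x \<le> t"] by (simp add: not_le)
      also have "{x\<in>space M. u x \<le> t} = {x\<in>space M. h x \<le> R + L * t}"
        using \<open>L > 0\<close> by (auto simp: u_def field_simps)
      also have "1 - prob {x\<in>space M. h x \<le> R + L * t} \<le> measure std_normal_distribution {t<..}"
        using tail[OF that] by simp
      finally show ?thesis
        by (simp add: emeasure_eq_measure std_normal.emeasure_eq_measure greaterThan_def del: std_normal_measure_greaterThan)
    qed
    then show "indicator {0<..} t * emeasure M {x\<in>space M. t < u x}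
        \<le> indicator {0<..} t * emeasure std_normal_distribution {s. t < s}"
      by (auto simp: indicator_def)
  qed
  also have "\<dots> = (\<integral>\<^sup>+s. ennreal s \<partial>std_normal_distribution)"
    using std_normal.nn_integral_layer_cake[of "\<lambda>s. s"] by simp
  finally have le: "(\<integral>\<^sup>+x. ennreal (u x) \<partial>M) \<le> ennreal (1 / sqrt (2 * pi))"
    by (simp only: nn_integral_std_normal_positive_part)
  \<comment> \<open>The Bochner integral does not discard negative values as \<open>ennreal\<close>
    does, so the positive part is made explicit.\<close>
  have max: "(\<integral>\<^sup>+x. ennreal (max 0 (u x)) \<partial>M) = (\<integral>\<^sup>+x. ennreal (u x) \<partial>M)"
    by (intro nn_integral_cong) (auto simp: max_def ennreal_neg)
  have int: "integrable M (\<lambda>x. max 0 (u x))"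
    using le by (intro integrableI_nonneg) (auto simp: max intro: le_less_trans)
  have "ennreal (expectation (\<lambda>x. max 0 (u x))) = (\<integral>\<^sup>+x. ennreal (max 0 (u x)) \<partial>M)"
    using int by (intro nn_integral_eq_integral[symmetric]) auto
  then have "ennreal (expectation (\<lambda>x. max 0 (u x))) \<le> ennreal (1 / sqrt (2 * pi))"
    using le by (simp only: max)
  then have exp_le: "expectation (\<lambda>x. max 0 (u x)) \<le> 1 / sqrt (2 * pi)"
    by (subst (asm) ennreal_le_iff) auto
  have bound: "h x \<le> R + L * max 0 (u x)" for x
    using \<open>L > 0\<close> by (auto simp: u_def max_def field_simps)
  have int': "integrable M (\<lambda>x. R + L * max 0 (u x))"
    using int by (intro Bochner_Integration.integrable_add integrable_mult_right) auto
  show "integrable M h"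
    using int' by (rule Bochner_Integration.integrable_bound) (use bound h0 in \<open>auto intro!: AE_I2 order_trans[OF bound]\<close>)
  then have "expectation h \<le> expectation (\<lambda>x. R + L * max 0 (u x))"
    using int' bound by (intro integral_mono) auto
  also have "\<dots> = R + L * expectation (\<lambda>x. max 0 (u x))"
    using int by (simp add: prob_space)
  also have "\<dots> \<le> R + L * (1 / sqrt (2 * pi))"
    using exp_le \<open>L > 0\<close> by (intro add_left_mono mult_left_mono) auto
  finally show "expectation h \<le> R + L / sqrt (2 * pi)" by simp
qed

lemma scaled_norm_eq: "scaled_norm (u :: real ^ 'n) = norm u / sqrt (real CARD('n))"
  by (simp add: scaled_norm_def norm_vec_def L2_set_def real_sqrt_divide)

section \<open>Standardising the noise\<close>

text \<open>The power of \<open>\<sigma>\<close> is the Jacobian of the scaling that standardises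
  the noise.\<close>

lemma isotropic_normal_density_scale:
  fixes x :: "real ^ 'n"
  assumes "\<sigma> > 0"
  shows "\<sigma> ^ CARD('n) * isotropic_normal_density \<sigma> (\<sigma> *\<^sub>R x) = gauss_density x"
proof -
  have one: "\<sigma> * normal_density 0 \<sigma> (\<sigma> * a) = 1 / sqrt (2 * pi) * exp (- a\<^sup>2 / 2)" for a
    using assms by (simp add: normal_density_def real_sqrt_mult power_mult_distrib)
  have "\<sigma> ^ CARD('n) * isotropic_normal_density \<sigma> (\<sigma> *\<^sub>R x)
      = (\<Prod>i\<in>UNIV. \<sigma> * normal_density 0 \<sigma> (\<sigma> * x $ i))"
    by (simp add: isotropic_normal_density_def prod.distrib)
  also have "\<dots> = (1 / sqrt (2 * pi)) ^ CARD('n) * exp (- (norm x)\<^sup>2 / 2)"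
    unfolding one power2_norm_eq_inner inner_vec_def
    by (simp add: prod_dividef sum_divide_distrib power2_eq_square power_divide flip: exp_sum sum_negf)
  finally show ?thesis by (simp add: gauss_density_norm)
qed

lemma distr_isotropic_normal:
  fixes \<xi> :: "'w \<Rightarrow> real ^ 'n"
  assumes "\<sigma> > 0"
    and dist: "distributed M lborel \<xi> (\<lambda>x. ennreal (isotropic_normal_density \<sigma> x))"
  shows "distr M borel (\<lambda>\<omega>. (1 / \<sigma>) *\<^sub>R \<xi> \<omega>) = gauss"
proof -
  have [measurable]: "\<xi> \<in> measurable M borel"
    using distributed_measurable[OF dist] by simp
  have [measurable]: "isotropic_normal_density \<sigma> \<in> borel_measurable (borel :: (real ^ 'n) measure)"
    unfolding isotropic_normal_density_def by measurable
  show ?thesis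
  proof (rule measure_eqI)
    fix A :: "(real ^ 'n) set"
    assume "A \<in> sets (distr M borel (\<lambda>\<omega>. (1 / \<sigma>) *\<^sub>R \<xi> \<omega>))"
    then have [measurable]: "A \<in> sets borel" by simp
    have "emeasure (distr M borel (\<lambda>\<omega>. (1 / \<sigma>) *\<^sub>R \<xi> \<omega>)) A
        = emeasure M (\<xi> -` {x. (1 / \<sigma>) *\<^sub>R x \<in> A} \<inter> space M)"
      by (subst emeasure_distr) (auto intro!: arg_cong[where f="emeasure M"])
    also have "\<dots> = (\<integral>\<^sup>+x. ennreal (isotropic_normal_density \<sigma> x) * indicator {x. (1 / \<sigma>) *\<^sub>R x \<in> A} x \<partial>lborel)"
      by (intro distributed_emeasure[OF dist]) measurable
    also have "\<dots> = (\<integral>\<^sup>+x. ennreal (\<sigma> ^ CARD('n)) *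
        (ennreal (isotropic_normal_density \<sigma> (\<sigma> *\<^sub>R x)) * indicator {x. (1 / \<sigma>) *\<^sub>R x \<in> A} (\<sigma> *\<^sub>R x)) \<partial>lborel)"
      using assms(1)
      by (subst lborel_affine[of \<sigma> 0]) (simp_all add: nn_integral_density nn_integral_distr)
    also have "\<dots> = (\<integral>\<^sup>+x. ennreal (gauss_density x) * indicator A x \<partial>lborel)"
    proof (intro nn_integral_cong)
      fix x :: "real ^ 'n"
      show "ennreal (\<sigma> ^ CARD('n)) *
          (ennreal (isotropic_normal_density \<sigma> (\<sigma> *\<^sub>R x)) * indicator {x. (1 / \<sigma>) *\<^sub>R x \<in> A} (\<sigma> *\<^sub>R x))
          = ennreal (gauss_density x) * indicator A x"
        unfolding isotropic_normal_density_scale[OF assms(1), symmetric]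
        using assms(1) by (simp add: ennreal_mult' mult.assoc indicator_def)
    qed
    also have "\<dots> = emeasure gauss A" unfolding gauss_def by (simp add: emeasure_density)
    finally show "emeasure (distr M borel (\<lambda>\<omega>. (1 / \<sigma>) *\<^sub>R \<xi> \<omega>)) A = emeasure gauss A" .
  qed simp
qed

section \<open>The penalised estimator as a proximal map\<close>

text \<open>First-order optimality without subgradients: \<open>\<beta>\<close> is compared with
  points of the segment towards \<open>b\<close>, and the difference of losses is divided by the
  step \<open>s\<close>. The factor \<open>CARD('n)\<close> undoes the scaling of the norm, and the
  2 before \<open>F\<close> matches the 2 of the cross term.\<close>

lemma penalized_least_squares_variational:
  fixes X :: "real ^ 'p ^ 'n"
  assumes "proper_convex F"
    and min: "\<And>\<gamma>. penalized_loss X F v \<beta> \<le> penalized_loss X F v \<gamma>"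
    and fin: "F \<beta> < \<infinity>" "F b < \<infinity>"
  shows "(v - X *v \<beta>) \<bullet> (X *v b - X *v \<beta>) \<le> real CARD('n) * (enn2real (F b) - enn2real (F \<beta>))"
proof -
  define p where "p = (v - X *v \<beta>) \<bullet> (X *v b - X *v \<beta>)"
  define q where "q = (norm (X *v b - X *v \<beta>))\<^sup>2"
  define K where "K = real CARD('n) * (enn2real (F b) - enn2real (F \<beta>))"
  have nonneg: "0 \<le> enn2real (F b)" "0 \<le> enn2real (F \<beta>)" by auto
  have F: "F b = ennreal (enn2real (F b))" "F \<beta> = ennreal (enn2real (F \<beta>))"
    using fin by auto
  have step: "p - s * q / 2 \<le> K" if s: "0 < s" "s \<le> 1" for s
  proof -
    define \<gamma> where "\<gamma> = (1 - s) *\<^sub>R \<beta> + s *\<^sub>R b"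
    have X\<gamma>: "v - X *v \<gamma> = (v - X *v \<beta>) - s *\<^sub>R (X *v b - X *v \<beta>)"
      by (simp add: \<gamma>_def matrix_vector_right_distrib matrix_vector_mult_scaleR algebra_simps)
    have "F \<gamma> \<le> ennreal (1 - s) * F \<beta> + ennreal s * F b"
      using assms(1) s unfolding proper_convex_def \<gamma>_def by (metis diff_ge_0_iff_ge diff_add_cancel less_imp_le)
    also have "\<dots> = ennreal ((1 - s) * enn2real (F \<beta>) + s * enn2real (F b))"
    proof -
      have "ennreal (1 - s) * F \<beta> = ennreal ((1 - s) * enn2real (F \<beta>))"
        using s by (subst F(2)) (simp add: ennreal_mult)
      moreover have "ennreal s * F b = ennreal (s * enn2real (F b))"
        using s by (subst F(1)) (simp add: ennreal_mult)
      ultimately show ?thesis using s nonneg by simp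
    qed
    finally have F\<gamma>: "F \<gamma> \<le> ennreal ((1 - s) * enn2real (F \<beta>) + s * enn2real (F b))" .
    have "ennreal ((scaled_norm (v - X *v \<beta>))\<^sup>2 + 2 * enn2real (F \<beta>)) = penalized_loss X F v \<beta>"
      unfolding penalized_loss_def by (subst (2) F) (simp add: ennreal_mult)
    also have "\<dots> \<le> penalized_loss X F v \<gamma>" by (rule min)
    also have "\<dots> \<le> ennreal ((scaled_norm (v - X *v \<gamma>))\<^sup>2)
        + 2 * ennreal ((1 - s) * enn2real (F \<beta>) + s * enn2real (F b))"
      unfolding penalized_loss_def by (intro add_left_mono mult_left_mono F\<gamma>) auto
    also have "\<dots> = ennreal ((scaled_norm (v - X *v \<gamma>))\<^sup>2
        + 2 * ((1 - s) * enn2real (F \<beta>) + s * enn2real (F b)))"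
      using s nonneg by (simp add: ennreal_mult)
    finally have "(scaled_norm (v - X *v \<beta>))\<^sup>2 + 2 * enn2real (F \<beta>)
        \<le> (scaled_norm (v - X *v \<gamma>))\<^sup>2 + 2 * ((1 - s) * enn2real (F \<beta>) + s * enn2real (F b))"
      using s nonneg by (subst (asm) ennreal_le_iff) auto
    moreover have "((norm (v - X *v \<gamma>))\<^sup>2 + 2 * s * K) / real CARD('n)
        = (norm (v - X *v \<gamma>))\<^sup>2 / real CARD('n) + 2 * s * (enn2real (F b) - enn2real (F \<beta>))"
      by (simp add: K_def add_divide_distrib)
    ultimately have "(norm (v - X *v \<beta>))\<^sup>2 / real CARD('n)
        \<le> ((norm (v - X *v \<gamma>))\<^sup>2 + 2 * s * K) / real CARD('n)"
      by (simp add: scaled_norm_eq power_divide algebra_simps)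
    then have "(norm (v - X *v \<beta>))\<^sup>2 \<le> (norm (v - X *v \<gamma>))\<^sup>2 + 2 * s * K"
      by (simp add: divide_le_cancel)
    moreover have "(norm (v - X *v \<gamma>))\<^sup>2 = (norm (v - X *v \<beta>))\<^sup>2 - 2 * s * p + s\<^sup>2 * q"
      unfolding X\<gamma> p_def q_def power2_norm_eq_inner
      by (simp add: inner_diff_left inner_diff_right inner_commute algebra_simps power2_eq_square)
    ultimately have "s * (p - s * q / 2) \<le> s * K"
      by (simp add: algebra_simps power2_eq_square)
    then show ?thesis using s by simp
  qed
  have "p \<le> K"
  proof (rule ccontr)
    assume "\<not> p \<le> K"
    then have d: "p - K > 0" by simp
    have q: "q \<ge> 0" by (simp add: q_def)
    \<comment> \<open>A step small enough that the quadratic remainder \<open>s * q / 2\<close>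
      cannot close the gap \<open>p - K\<close>; the \<open>+ 1\<close> covers
      \<open>q = 0\<close>.\<close>
    define s where "s = min 1 ((p - K) / (q + 1))"
    have s: "0 < s" "s \<le> 1" "s \<le> (p - K) / (q + 1)" using d q by (auto simp: s_def)
    have "s * q \<le> s * (q + 1)" using s by simp
    also have "\<dots> \<le> p - K" using s(3) q by (simp add: pos_le_divide_eq)
    finally show False using step[OF s(1,2)] d by linarith
  qed
  then show ?thesis by (simp add: p_def K_def)
qed

text \<open>Adding the optimality inequalities of the two minimisers, each tested against the other,
  cancels the penalties. What remains is \<open>d \<bullet> d \<le> (v' - v) \<bullet> d\<close>,
  and Cauchy-Schwarz finishes.\<close>

lemma penalized_least_squares_nonexpansive:
  fixes X :: "real ^ 'p ^ 'n"
  assumes F: "proper_convex F"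
    and arg_min: "\<And>v. is_arg_min (penalized_loss X F v) (\<lambda>_. True) (\<beta> v)"
  shows "norm (X *v \<beta> v' - X *v \<beta> v) \<le> norm (v' - v)"
proof -
  have min: "penalized_loss X F v (\<beta> v) \<le> penalized_loss X F v \<gamma>" for v \<gamma>
    using arg_min[of v] by (auto simp: is_arg_min_def not_less)
  have fin: "F (\<beta> v) < \<infinity>" for v
  proof -
    obtain x where "F x < \<infinity>" using F by (auto simp: proper_convex_def)
    then have "penalized_loss X F v x < \<infinity>"
      by (auto simp: penalized_loss_def ennreal_mult_less_top)
    then have "penalized_loss X F v (\<beta> v) < \<infinity>" using min[of v x] by (rule le_less_trans[rotated])
    then show ?thesis by (auto simp: penalized_loss_def ennreal_mult_less_top)
  qed
  define d where "d = X *v \<beta> v' - X *v \<beta> v"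
  have "(v - X *v \<beta> v) \<bullet> d \<le> real CARD('n) * (enn2real (F (\<beta> v')) - enn2real (F (\<beta> v)))"
    unfolding d_def by (rule penalized_least_squares_variational[OF F min fin fin])
  moreover have "(v' - X *v \<beta> v') \<bullet> (- d) \<le> real CARD('n) * (enn2real (F (\<beta> v)) - enn2real (F (\<beta> v')))"
    using penalized_least_squares_variational[OF F min fin fin, of v' v] by (simp add: d_def)
  ultimately have "(v - X *v \<beta> v) \<bullet> d - (v' - X *v \<beta> v') \<bullet> d \<le> 0"
    by (simp add: algebra_simps)
  then have "d \<bullet> d \<le> (v' - v) \<bullet> d"
    by (simp add: d_def inner_diff_left)
  also have "\<dots> \<le> norm (v' - v) * norm d" by (rule norm_cauchy_schwarz)
  finally have "norm d * norm d \<le> norm (v' - v) * norm d"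
    by (simp add: power2_norm_eq_inner[symmetric] power2_eq_square)
  then show ?thesis
    by (cases "norm d = 0") (auto simp: d_def[symmetric])
qed

section \<open>Medians and the final assembly\<close>

text \<open>The witness is the lower median, the infimum of the levels where the distribution
  function reaches 1/2. Right continuity gives one median inequality there, and the left limit gives
  the other.\<close>

lemma (in prob_space) half_le_cdf_iff_median_le:
  fixes Z :: "'a \<Rightarrow> real"
  assumes [measurable]: "Z \<in> borel_measurable M"
  shows "1 / 2 \<le> prob {\<omega>\<in>space M. Z \<omega> \<le> R} \<longleftrightarrow> (\<exists>m. is_median M Z m \<and> m \<le> R)"
proof
  assume R: "1 / 2 \<le> prob {\<omega>\<in>space M. Z \<omega> \<le> R}"
  interpret D: real_distribution "distr M borel Z"
    by (rule real_distribution_distr) measurable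
  have cdf: "cdf (distr M borel Z) x = prob {\<omega>\<in>space M. Z \<omega> \<le> x}" for x
    unfolding cdf_def by (subst measure_distr) (auto intro!: arg_cong[where f=prob])
  define S where "S = {x. 1 / 2 \<le> cdf (distr M borel Z) x}"
  have "R \<in> S" using R by (simp add: S_def cdf)
  obtain b where b: "\<And>x. x \<le> b \<Longrightarrow> cdf (distr M borel Z) x < 1 / 2"
    using order_tendstoD(2)[OF D.cdf_lim_at_bot, of "1 / 2"] by (auto simp: eventually_at_bot_linorder)
  have bdd: "bdd_below S"
    using b unfolding bdd_below_def S_def by (metis linorder_le_cases mem_Collect_eq not_le)
  define m where "m = Inf S"
  have "m \<le> R" unfolding m_def using \<open>R \<in> S\<close> bdd by (rule cInf_lower)
  have above: "1 / 2 \<le> cdf (distr M borel Z) x" if less: "m < x" for x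
  proof -
    obtain s where "s \<in> S" "s < x"
      using less cInf_lessD[of S x] \<open>R \<in> S\<close> by (auto simp: m_def)
    then show ?thesis using D.cdf_nondecreasing[of s x] by (auto simp: S_def)
  qed
  have "1 / 2 \<le> cdf (distr M borel Z) m"
  proof (rule tendsto_lowerbound)
    show "(cdf (distr M borel Z) \<longlongrightarrow> cdf (distr M borel Z) m) (at_right m)"
      using D.cdf_is_right_cont[of m] by (simp add: continuous_within)
    show "\<forall>\<^sub>F x in at_right m. 1 / 2 \<le> cdf (distr M borel Z) x"
      using above by (auto simp: eventually_at_right_field intro!: exI[of _ "m + 1"])
  qed simp
  moreover have "measure (distr M borel Z) {..<m} \<le> 1 / 2"
  proof (rule tendsto_upperbound)
    show "(cdf (distr M borel Z) \<longlongrightarrow> measure (distr M borel Z) {..<m}) (at_left m)"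
      by (rule D.cdf_at_left)
    have "cdf (distr M borel Z) x \<le> 1 / 2" if "x < m" for x
      using that cInf_lower[OF _ bdd, of x] by (force simp: S_def m_def)
    then show "\<forall>\<^sub>F x in at_left m. cdf (distr M borel Z) x \<le> 1 / 2"
      by (auto simp: eventually_at_left_field intro!: exI[of _ "m - 1"])
  qed simp
  moreover have "measure (distr M borel Z) {..<m} = prob {\<omega>\<in>space M. Z \<omega> < m}"
    by (subst measure_distr) (auto intro!: arg_cong[where f=prob])
  moreover have "prob {\<omega>\<in>space M. m \<le> Z \<omega>} = 1 - prob {\<omega>\<in>space M. Z \<omega> < m}"
    using prob_neg[of "\<lambda>\<omega>. Z \<omega> < m"] by (simp add: not_less)
  ultimately have "is_median M Z m" by (simp add: is_median_def cdf)
  then show "\<exists>m. is_median M Z m \<and> m \<le> R" using \<open>m \<le> R\<close> by blast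
next
  assume "\<exists>m. is_median M Z m \<and> m \<le> R"
  then obtain m where m: "1 / 2 \<le> prob {\<omega>\<in>space M. Z \<omega> \<le> m}" "m \<le> R"
    by (auto simp: is_median_def)
  have "prob {\<omega>\<in>space M. Z \<omega> \<le> m} \<le> prob {\<omega>\<in>space M. Z \<omega> \<le> R}"
    using m(2) by (intro finite_measure_mono) auto
  then show "1 / 2 \<le> prob {\<omega>\<in>space M. Z \<omega> \<le> R}" using m(1) by linarith
qed

theorem theorem1:
  fixes M :: "'w measure"
    and X :: "real ^ 'p ^ 'n"
    and f :: "real ^ 'n"
    and \<sigma> R :: real
    and \<xi> y :: "'w \<Rightarrow> real ^ 'n"
    and F :: "real ^ 'p \<Rightarrow> ennreal"
    and \<beta>hat :: "real ^ 'n \<Rightarrow> real ^ 'p"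
    and Z :: "'w \<Rightarrow> real"
  assumes "prob_space M"
    and "\<sigma> > 0" and "R \<ge> 0"
    and "distributed M lborel \<xi> (\<lambda>x. ennreal (isotropic_normal_density \<sigma> x))"
    and "y = (\<lambda>\<omega>. f + \<xi> \<omega>)"
    and "proper_convex F"
    and "\<And>v. is_arg_min (penalized_loss X F v) (\<lambda>_. True) (\<beta>hat v)"
    and "Z = (\<lambda>\<omega>. scaled_norm (X *v \<beta>hat (y \<omega>) - f))"
  shows "(\<P>(\<omega> in M. Z \<omega> \<le> R) \<ge> 1/2 \<longleftrightarrow> (\<exists>m. is_median M Z m \<and> m \<le> R)) \<and>
    (\<P>(\<omega> in M. Z \<omega> \<le> R) \<ge> 1/2 \<longrightarrow>
       (\<forall>t>0. \<P>(\<omega> in M. Z \<omega> \<le> R + \<sigma> * t / sqrt (real CARD('n)))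
                \<ge> cdf std_normal_distribution t) \<and>
       (\<forall>x>0. \<P>(\<omega> in M. Z \<omega> \<le> R + \<sigma> * sqrt (2 * x / real CARD('n))) \<ge> 1 - exp (- x)) \<and>
       integrable M Z \<and>
       prob_space.expectation M Z \<le> R + \<sigma> / sqrt (2 * pi * real CARD('n)))"
proof -
  interpret prob_space M by fact
  \<comment> \<open>The loss as a function of the standardised noise \<open>N\<close>, whose law is
    \<open>gauss\<close>.\<close>
  define h where "h w = scaled_norm (X *v \<beta>hat (f + \<sigma> *\<^sub>R w) - f)" for w
  \<comment> \<open>The factor \<open>\<sigma>\<close> comes from standardising the noise, the
    factor \<open>1 / sqrt n\<close> from the scaled norm.\<close>
  define L where "L = \<sigma> / sqrt (real CARD('n))"
  define N where "N \<omega> = (1 / \<sigma>) *\<^sub>R \<xi> \<omega>" for \<omega>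
  have "L > 0" using \<open>\<sigma> > 0\<close> by (simp add: L_def)
  have lip: "\<bar>h w - h w'\<bar> \<le> L * dist w w'" for w w'
  proof -
    have "\<bar>h w - h w'\<bar> \<le> norm (X *v \<beta>hat (f + \<sigma> *\<^sub>R w) - X *v \<beta>hat (f + \<sigma> *\<^sub>R w')) / sqrt (real CARD('n))"
      using norm_triangle_ineq3[of "X *v \<beta>hat (f + \<sigma> *\<^sub>R w) - f" "X *v \<beta>hat (f + \<sigma> *\<^sub>R w') - f"]
      by (simp add: h_def scaled_norm_eq divide_right_mono flip: diff_divide_distrib)
    also have "\<dots> \<le> norm ((f + \<sigma> *\<^sub>R w) - (f + \<sigma> *\<^sub>R w')) / sqrt (real CARD('n))"
      by (intro divide_right_mono penalized_least_squares_nonexpansive[OF assms(6,7)]) auto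
    also have "\<dots> = L * dist w w'"
      using \<open>\<sigma> > 0\<close> by (simp add: L_def dist_norm flip: scaleR_diff_right)
    finally show ?thesis .
  qed
  \<comment> \<open>Measurability of the loss comes from this continuity: \<open>\<beta>hat\<close>
    may select minimisers arbitrarily, but the fitted values depend continuously on the
    data.\<close>
  have "L-lipschitz_on UNIV h"
    using lip \<open>L > 0\<close> by (intro lipschitz_onI) (auto simp: dist_real_def)
  then have h [measurable]: "h \<in> borel_measurable borel"
    by (intro borel_measurable_continuous_onI lipschitz_on_continuous_on)
  have [measurable]: "\<xi> \<in> measurable M borel"
    using distributed_measurable[OF assms(4)] by simp
  have N [measurable]: "N \<in> measurable M borel" unfolding N_def by measurable
  have Z: "Z = (\<lambda>\<omega>. h (N \<omega>))"
    using \<open>\<sigma> > 0\<close> by (simp add: assms(5,8) h_def N_def)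
  have [measurable]: "Z \<in> borel_measurable M" unfolding Z by measurable
  have "distr M borel N = gauss"
    using distr_isotropic_normal[OF assms(2,4)] by (simp add: N_def[abs_def])
  then have prob_Z: "prob {\<omega>\<in>space M. Z \<omega> \<le> r} = measure gauss {w. h w \<le> r}" for r
    by (subst \<open>distr M borel N = gauss\<close>[symmetric], subst measure_distr)
      (auto simp: Z intro!: arg_cong[where f=prob])
  show ?thesis
  proof (intro conjI impI)
    show "1 / 2 \<le> prob {\<omega>\<in>space M. Z \<omega> \<le> R} \<longleftrightarrow> (\<exists>m. is_median M Z m \<and> m \<le> R)"
      by (rule half_le_cdf_iff_median_le) measurable
  next
    assume "1 / 2 \<le> prob {\<omega>\<in>space M. Z \<omega> \<le> R}"
    then have half: "1 / 2 \<le> measure gauss {w. h w \<le> R}" by (simp add: prob_Z)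
    have tail: "Phi t \<le> prob {\<omega>\<in>space M. Z \<omega> \<le> R + L * t}" if "t > 0" for t
      unfolding prob_Z by (rule gauss_lipschitz_concentration[OF lip \<open>L > 0\<close> half that])
    then show "\<forall>t>0. Phi t \<le> prob {\<omega>\<in>space M. Z \<omega> \<le> R + \<sigma> * t / sqrt (real CARD('n))}"
      by (simp add: L_def)
    show "\<forall>x>0. 1 - exp (- x) \<le> prob {\<omega>\<in>space M. Z \<omega> \<le> R + \<sigma> * sqrt (2 * x / real CARD('n))}"
    proof (intro allI impI)
      fix x :: real assume "x > 0"
      have "1 - exp (- x) \<le> Phi (sqrt (2 * x))" using \<open>x > 0\<close> by (rule Phi_ge_exp)
      also have "\<dots> \<le> prob {\<omega>\<in>space M. Z \<omega> \<le> R + L * sqrt (2 * x)}"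
        using \<open>x > 0\<close> by (intro tail) simp
      also have "L * sqrt (2 * x) = \<sigma> * sqrt (2 * x / real CARD('n))"
        by (simp add: L_def real_sqrt_divide)
      finally show "1 - exp (- x) \<le> prob {\<omega>\<in>space M. Z \<omega> \<le> R + \<sigma> * sqrt (2 * x / real CARD('n))}" .
    qed
    have Z0: "0 \<le> Z \<omega>" for \<omega> by (simp add: Z h_def scaled_norm_eq)
    show "integrable M Z"
      by (rule expectation_le_gaussian_tail(1)[OF _ Z0 \<open>L > 0\<close> tail]) measurable
    have "expectation Z \<le> R + L / sqrt (2 * pi)"
      by (rule expectation_le_gaussian_tail(2)[OF _ Z0 \<open>L > 0\<close> tail]) measurable
    then show "expectation Z \<le> R + \<sigma> / sqrt (2 * pi * real CARD('n))"
      by (simp add: L_def real_sqrt_mult mult.commute)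
  qed
qed

end
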